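(* Let $T$ be a complete first-order theory with bounded $k$-splitting (where $k\ge 1$), let $B$ be a set of parameters in a model of $T$, let $\gamma$ be an ordinal, and let $\mu > |T|+|B|+|\gamma|$ be a $k$-ineffable cardinal. Then for any sequence $(a_i)_{i<\mu}$ of $\gamma$-tuples of parameters (in a model of $T$), there is a set $X\subseteq \mu$ with $|X|=\mu$ such that $(a_i)_{i\in X}$ is indiscernible over $B$.
   Context: Work in a monster model of $T$; $b\equiv_C b'$ means $b$ and $b'$ have the same type over $C$. For a list $a_0,\dots,a_{k-1}$, the expression $a_0,\dots,\hat a_i,\dots,a_{k-1}$ denotes the list with $a_i$ removed. A $k$-partitioned type $\mathrm{tp}(a_0;\dots;a_{k-1}/B)$ is a type whose variables are partitioned into $k$ designated groups. Such a type $k$-splits over $C\subseteq B$ if there are a formula $\varphi(x_0,\dots,x_{k-1},y)$ and tuples $b,b'$ from $B$ such that $b\equiv_{C a_0\dots\hat a_i\dots a_{k-1}} b'$ for each $i<k$, while $\varphi(a_0,\dots,a_{k-1},b)$ and $\neg\varphi(a_0,\dots,a_{k-1},b')$ hold. $T$ has $\lambda$-bounded $k$-splitting if for every finite $n$, every set $B$ and every $k$-partitioned type $\mathrm{tp}(a_0;\dots;a_{k-1}/B)$ with each $a_i$ an $n$-tuple, there is $C\subseteq B$ with $|C|<\lambda$ such that the type does not $k$-split over $C$; $T$ has bounded $k$-splitting if it has $\lambda$-bounded $k$-splitting for some cardinal $\lambda$. A function $f:[\mu]^k\to \mathcal P(\mu)$ is regressive if $f(A)\subseteq \min A$ for all $A\in[\mu]^k$;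 a set $X\subseteq\mu$ is $f$-homogeneous if $f(A)\cap\min(A\cup A')=f(A')\cap\min(A\cup A')$ for all $A,A'\in[X]^k$. A limit cardinal $\mu$ is $k$-ineffable if for every regressive $f:[\mu]^k\to\mathcal P(\mu)$ there is a stationary $f$-homogeneous set $X\subseteq\mu$. *)

theory Defs
  imports Main "HOL-Library.Ramsey"
begin

unbundle cardinal_syntax

section \<open>First-order logic\<close>

text \<open>
  The symbols of a language are subsets of the types \<open>'f\<close> and \<open>'r\<close>, so that a language may have no
  function symbols or no relation symbols, and may have any cardinality. Constants are function
  symbols of arity 0.
\<close>

record ('f, 'r) language =
  Funs :: "'f set"
  Rels :: "'r set"
  farity :: "'f \<Rightarrow> nat"
  rarity :: "'r \<Rightarrow> nat"

datatype 'f tm = Var nat | Fn 'f "'f tm list"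

datatype ('f, 'r) fm =
    Eq "'f tm" "'f tm"
  | Rel 'r "'f tm list"
  | Neg "('f, 'r) fm"
  | Conj "('f, 'r) fm" "('f, 'r) fm"
  | Ex nat "('f, 'r) fm"

fun fv_tm :: "'f tm \<Rightarrow> nat set" where
  "fv_tm (Var x) = {x}"
| "fv_tm (Fn f ts) = (\<Union>t\<in>set ts. fv_tm t)"

fun fv :: "('f, 'r) fm \<Rightarrow> nat set" where
  "fv (Eq s t) = fv_tm s \<union> fv_tm t"
| "fv (Rel r ts) = (\<Union>t\<in>set ts. fv_tm t)"
| "fv (Neg \<phi>) = fv \<phi>"
| "fv (Conj \<phi> \<psi>) = fv \<phi> \<union> fv \<psi>"
| "fv (Ex x \<phi>) = fv \<phi> - {x}"

fun wf_tm :: "('f, 'r) language \<Rightarrow> 'f tm \<Rightarrow> bool" where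
  "wf_tm L (Var x) = True"
| "wf_tm L (Fn f ts) =
    (f \<in> Funs L \<and> length ts = farity L f \<and> (\<forall>t\<in>set ts. wf_tm L t))"

fun wf_fm :: "('f, 'r) language \<Rightarrow> ('f, 'r) fm \<Rightarrow> bool" where
  "wf_fm L (Eq s t) = (wf_tm L s \<and> wf_tm L t)"
| "wf_fm L (Rel r ts) =
    (r \<in> Rels L \<and> length ts = rarity L r \<and> (\<forall>t\<in>set ts. wf_tm L t))"
| "wf_fm L (Neg \<phi>) = wf_fm L \<phi>"
| "wf_fm L (Conj \<phi> \<psi>) = (wf_fm L \<phi> \<and> wf_fm L \<psi>)"
| "wf_fm L (Ex x \<phi>) = wf_fm L \<phi>"

definition formulas :: "('f, 'r) language \<Rightarrow> ('f, 'r) fm set" where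
  "formulas L = {\<phi>. wf_fm L \<phi>}"

definition sentences :: "('f, 'r) language \<Rightarrow> ('f, 'r) fm set" where
  "sentences L = {\<phi> \<in> formulas L. fv \<phi> = {}}"

record ('f, 'r, 'm) struct =
  Dom :: "'m set"
  fint :: "'f \<Rightarrow> 'm list \<Rightarrow> 'm"
  rint :: "'r \<Rightarrow> 'm list \<Rightarrow> bool"

definition structure_of :: "('f, 'r) language \<Rightarrow> ('f, 'r, 'm) struct \<Rightarrow> bool" where
  "structure_of L M \<longleftrightarrow> Dom M \<noteq> {} \<and>
    (\<forall>f\<in>Funs L. \<forall>xs. set xs \<subseteq> Dom M \<and> length xs = farity L f \<longrightarrow> fint M f xs \<in> Dom M)"

fun eval_tm :: "('f, 'r, 'm) struct \<Rightarrow> (nat \<Rightarrow> 'm) \<Rightarrow> 'f tm \<Rightarrow> 'm" where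
  "eval_tm M e (Var x) = e x"
| "eval_tm M e (Fn f ts) = fint M f (map (eval_tm M e) ts)"

fun sat :: "('f, 'r, 'm) struct \<Rightarrow> (nat \<Rightarrow> 'm) \<Rightarrow> ('f, 'r) fm \<Rightarrow> bool" where
  "sat M e (Eq s t) \<longleftrightarrow> eval_tm M e s = eval_tm M e t"
| "sat M e (Rel r ts) \<longleftrightarrow> rint M r (map (eval_tm M e) ts)"
| "sat M e (Neg \<phi>) \<longleftrightarrow> \<not> sat M e \<phi>"
| "sat M e (Conj \<phi> \<psi>) \<longleftrightarrow> sat M e \<phi> \<and> sat M e \<psi>"
| "sat M e (Ex x \<phi>) \<longleftrightarrow> (\<exists>m\<in>Dom M. sat M (e(x := m)) \<phi>)"

text \<open>
  For a formula with free variables among \<open>0, \<dots>, length xs - 1\<close>, this is satisfaction by the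
  finite tuple \<open>xs\<close>.
\<close>

abbreviation sat_list :: "('f, 'r, 'm) struct \<Rightarrow> 'm list \<Rightarrow> ('f, 'r) fm \<Rightarrow> bool" where
  "sat_list M xs \<phi> \<equiv> sat M (\<lambda>i. xs ! i) \<phi>"

definition is_model :: "('f, 'r) language \<Rightarrow> ('f, 'r) fm set \<Rightarrow> ('f, 'r, 'm) struct \<Rightarrow> bool" where
  "is_model L T M \<longleftrightarrow> structure_of L M \<and> (\<forall>\<phi>\<in>T. sat_list M [] \<phi>)"

text \<open>
  Consistency and consequence are tested on models whose points lie in the type
  \<open>'f + 'r + nat\<close>. This type is infinite and has at least as many elements as there are symbols, so by
  the downward Loewenheim-Skolem theorem (and since finite models also fit) nothing is lost.
\<close>

definition entails :: "('f, 'r) language \<Rightarrow> ('f, 'r) fm set \<Rightarrow> ('f, 'r) fm \<Rightarrow> bool" where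
  "entails L T \<phi> \<longleftrightarrow>
    (\<forall>M :: ('f, 'r, 'f + 'r + nat) struct. is_model L T M \<longrightarrow> sat_list M [] \<phi>)"

definition consistent :: "('f, 'r) language \<Rightarrow> ('f, 'r) fm set \<Rightarrow> bool" where
  "consistent L T \<longleftrightarrow> (\<exists>M :: ('f, 'r, 'f + 'r + nat) struct. is_model L T M)"

definition complete_theory :: "('f, 'r) language \<Rightarrow> ('f, 'r) fm set \<Rightarrow> bool" where
  "complete_theory L T \<longleftrightarrow> T \<subseteq> sentences L \<and> consistent L T \<and>
    (\<forall>\<phi>\<in>sentences L. entails L T \<phi> \<or> entails L T (Neg \<phi>))"

section \<open>Types\<close>

text \<open>
  The complete type over \<open>D\<close> of the (possibly infinite) tuple \<open>c\<close> indexed by \<open>I\<close>. A triple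
  \<open>(\<phi>, s, d)\<close> stands for the formula \<open>\<phi>(x\<^sub>s\<^sub>0, \<dots>, x\<^sub>s\<^sub>m, d)\<close> with parameters \<open>d\<close> from \<open>D\<close>, in the variables
  \<open>x\<^sub>i\<close> for \<open>i \<in> I\<close>. Since a type does not change when the model is replaced by an elementary
  extension, it may be computed in any model containing \<open>c\<close> and \<open>D\<close>; no ambient monster model is needed.
\<close>

definition tp ::
  "('f, 'r) language \<Rightarrow> ('f, 'r, 'm) struct \<Rightarrow> 'm set \<Rightarrow> 'i set \<Rightarrow> ('i \<Rightarrow> 'm) \<Rightarrow>
    (('f, 'r) fm \<times> 'i list \<times> 'm list) set" where
  "tp L M D I c = {(\<phi>, s, d). \<phi> \<in> formulas L \<and> set s \<subseteq> I \<and> set d \<subseteq> D \<and>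
    fv \<phi> \<subseteq> {..<length s + length d} \<and> sat_list M (map c s @ d) \<phi>}"

definition same_type_over ::
  "('f, 'r) language \<Rightarrow> ('f, 'r, 'm) struct \<Rightarrow> 'm set \<Rightarrow> 'm list \<Rightarrow> 'm list \<Rightarrow> bool" where
  "same_type_over L M D b b' \<longleftrightarrow> length b = length b' \<and>
    tp L M D {..<length b} (\<lambda>i. b ! i) = tp L M D {..<length b'} (\<lambda>i. b' ! i)"

section \<open>Bounded splitting\<close>

text \<open>
  \<open>k_splits L M a B C\<close>: the \<open>k\<close>-partitioned type \<open>tp(a\<^sub>0; \<dots>; a\<^sub>k\<^sub>-\<^sub>1/B)\<close> splits over \<open>C\<close>, where
  \<open>a\<close> is the list of the \<open>k\<close> tuples.
\<close>

definition k_splits ::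
  "('f, 'r) language \<Rightarrow> ('f, 'r, 'm) struct \<Rightarrow> 'm list list \<Rightarrow> 'm set \<Rightarrow> 'm set \<Rightarrow> bool" where
  "k_splits L M a B C \<longleftrightarrow> (\<exists>\<phi> b b'. \<phi> \<in> formulas L \<and> set b \<subseteq> B \<and> set b' \<subseteq> B \<and>
     length b = length b' \<and> fv \<phi> \<subseteq> {..<length (concat a) + length b} \<and>
     (\<forall>i<length a.
        same_type_over L M (C \<union> (\<Union>j\<in>{..<length a} - {i}. set (a ! j))) b b') \<and>
     sat_list M (concat a @ b) \<phi> \<and> \<not> sat_list M (concat a @ b') \<phi>)"

text \<open>
  HOL cannot quantify over types inside a formula. The argument of type \<open>'u itself\<close> names the type
  in which the points of the models of \<open>T\<close> are taken.
\<close>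

definition lambda_bounded_k_splitting ::
  "'u itself \<Rightarrow> ('f, 'r) language \<Rightarrow> ('f, 'r) fm set \<Rightarrow> nat \<Rightarrow> 'l rel \<Rightarrow> bool" where
  "lambda_bounded_k_splitting U L T k lam \<longleftrightarrow>
    (\<forall>(M :: ('f, 'r, 'u) struct) n B a.
       is_model L T M \<and> B \<subseteq> Dom M \<and> length a = k \<and>
       (\<forall>x\<in>set a. length x = n \<and> set x \<subseteq> Dom M) \<longrightarrow>
       (\<exists>C\<subseteq>B. |C| <o lam \<and> \<not> k_splits L M a B C))"

text \<open>
  The cardinal \<open>\<lambda>\<close> is a cardinal order on the type \<open>'l\<close>; as \<open>'l\<close> is a free type variable of a
  theorem that has this property as a hypothesis, \<open>\<lambda>\<close> is arbitrary there. The points of the models range over a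
  type of cardinality at least the successor of \<open>\<lambda> + |L| + \<aleph>\<^sub>0\<close>. By
  compactness and Loewenheim-Skolem that is large enough: if \<open>\<lambda>\<close>-boundedness holds for
  these models, then \<open>T\<close> has bounded \<open>k\<close>-splitting in models of any size. A type
  of cardinality at most \<open>\<lambda>\<close> would not do, because there \<open>C = B\<close> could be a trivial choice.
\<close>

definition bounded_k_splitting ::
  "'l itself \<Rightarrow> ('f, 'r) language \<Rightarrow> ('f, 'r) fm set \<Rightarrow> nat \<Rightarrow> bool" where
  "bounded_k_splitting _ L T k \<longleftrightarrow>
    (\<exists>lam :: 'l rel. Card_order lam \<and>
       lambda_bounded_k_splitting TYPE(('l + 'f + 'r + nat) set) L T k lam)"

section \<open>Ineffable cardinals\<close>

text \<open>
  A cardinal is a cardinal order \<open>\<mu>\<close>. The ordinals below it are the elements of \<open>Field \<mu>\<close>, and the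
  ordinal \<open>\<alpha>\<close>, as the set of its predecessors, is \<open>underS \<mu> \<alpha>\<close>.
\<close>

definition limit_cardinal :: "'c rel \<Rightarrow> bool" where
  "limit_cardinal \<mu> \<longleftrightarrow> Card_order \<mu> \<and> infinite (Field \<mu>) \<and>
    (\<forall>\<nu> :: 'c rel. Card_order \<nu> \<and> \<nu> <o \<mu> \<longrightarrow> cardSuc \<nu> <o \<mu>)"

text \<open>
  The hypotheses on \<open>\<delta>\<close> in the second part say that \<open>\<delta>\<close> is a limit ordinal below \<open>\<mu>\<close> and that
  \<open>C \<inter> \<delta>\<close> is unbounded in \<open>\<delta>\<close>.
\<close>

definition club :: "'c rel \<Rightarrow> 'c set \<Rightarrow> bool" where
  "club \<mu> C \<longleftrightarrow> C \<subseteq> Field \<mu> \<and> cofinal C \<mu> \<and>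
    (\<forall>\<delta>\<in>Field \<mu>. underS \<mu> \<delta> \<noteq> {} \<and>
       (\<forall>\<beta>\<in>underS \<mu> \<delta>. \<exists>\<gamma>\<in>C \<inter> underS \<mu> \<delta>. \<beta> \<in> underS \<mu> \<gamma>) \<longrightarrow> \<delta> \<in> C)"

definition stationary :: "'c rel \<Rightarrow> 'c set \<Rightarrow> bool" where
  "stationary \<mu> X \<longleftrightarrow> X \<subseteq> Field \<mu> \<and> (\<forall>C. club \<mu> C \<longrightarrow> X \<inter> C \<noteq> {})"

definition regressive :: "'c rel \<Rightarrow> nat \<Rightarrow> ('c set \<Rightarrow> 'c set) \<Rightarrow> bool" where
  "regressive \<mu> k f \<longleftrightarrow> (\<forall>A\<in>[Field \<mu>]\<^bsup>k\<^esup>. f A \<subseteq> underS \<mu> (wo_rel.minim \<mu> A))"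

definition homogeneous :: "'c rel \<Rightarrow> nat \<Rightarrow> ('c set \<Rightarrow> 'c set) \<Rightarrow> 'c set \<Rightarrow> bool" where
  "homogeneous \<mu> k f X \<longleftrightarrow> (\<forall>A\<in>[X]\<^bsup>k\<^esup>. \<forall>A'\<in>[X]\<^bsup>k\<^esup>.
     f A \<inter> underS \<mu> (wo_rel.minim \<mu> (A \<union> A')) = f A' \<inter> underS \<mu> (wo_rel.minim \<mu> (A \<union> A')))"

definition ineffable :: "nat \<Rightarrow> 'c rel \<Rightarrow> bool" where
  "ineffable k \<mu> \<longleftrightarrow> limit_cardinal \<mu> \<and>
    (\<forall>f. regressive \<mu> k f \<longrightarrow> (\<exists>X. stationary \<mu> X \<and> homogeneous \<mu> k f X))"

section \<open>Indiscernible sequences\<close>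

text \<open>
  \<open>a \<alpha>\<close>, for \<open>\<alpha> \<in> Field \<mu>\<close>, is a tuple indexed by \<open>G\<close>. The concatenation of \<open>a (i ! 0)\<close>, \<open>a (i ! 1)\<close>,
  and so on is the tuple indexed by \<open>{..<length i} \<times> G\<close>.
\<close>

definition indiscernible_over ::
  "('f, 'r) language \<Rightarrow> ('f, 'r, 'm) struct \<Rightarrow> 'm set \<Rightarrow> 'c rel \<Rightarrow> 'c set \<Rightarrow> 'g set \<Rightarrow>
    ('c \<Rightarrow> 'g \<Rightarrow> 'm) \<Rightarrow> bool" where
  "indiscernible_over L M B \<mu> X G a \<longleftrightarrow>
    (\<forall>i j. set i \<subseteq> X \<and> set j \<subseteq> X \<and> length i = length j \<and>
       sorted_wrt (\<lambda>\<alpha> \<beta>. \<alpha> \<in> underS \<mu> \<beta>) i \<and> sorted_wrt (\<lambda>\<alpha> \<beta>. \<alpha> \<in> underS \<mu> \<beta>) j \<longrightarrow>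
       tp L M B ({..<length i} \<times> G) (\<lambda>(p, g). a (i ! p) g) =
       tp L M B ({..<length j} \<times> G) (\<lambda>(p, g). a (j ! p) g))"

end

theory Submission
  imports Defs
begin

text \<open>
  Bounded \<open>k\<close>-splitting implies that a fixed formula does not witness \<open>k\<close>-splitting along chains of arbitrary finite
  length: otherwise compactness and Loewenheim-Skolem give such a chain of length \<open>\<kappa>\<close>, for a regular
  \<open>\<kappa>\<close> above the splitting bound \<open>\<lambda>\<close>, in a model on the type that the hypothesis speaks about.

  By \<open>k\<close>-ineffability there is an unbounded \<open>X \<subseteq> \<mu>\<close> on which the types of \<open>a\<^sub>A\<close> over \<open>B\<close> and the tuples before
  \<open>min A\<close>, for \<open>A \<in> [X]\<^sup>k\<close>, cohere. As \<open>\<mu>\<close> is regular, these types do not \<open>k\<close>-split over \<open>B\<close> and the tuples before some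
  \<open>\<delta> < \<mu>\<close>. Above \<open>\<delta>\<close>, increasing tuples of length \<open>N\<close> from \<open>X\<close> then have the same type, by
  induction on \<open>N\<close>: coherence moves the last \<open>k\<close> indices far up, and nonsplitting replaces the
  remaining ones, because by the induction hypothesis these have the same type over all but one of the last \<open>k\<close> tuples.
\<close>

section \<open>Cardinality of sets generated by finitary operations\<close>

text \<open>The bound \<lambda> is unrelated to \<mu>. Over fewer than \<lambda> parameters the
  hypothesis is vacuous, as the whole parameter set may serve as \<open>C\<close>, so it cannot be
  applied to the given sequence directly. What it yields is finitary: for a formula and given
  lengths, some \<open>N\<close> bounds the patterns in a given model. This involves no cardinal,
  and it holds in models of any size.

  Finite patterns suffice, because splitting over unboundedly many bases can be iterated
  \<open>N\<close> times. The formula has to stay fixed in this iteration. As \<gamma> may be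
  infinite while splitting concerns finite tuples, a finite list of coordinates is fixed with it;
  there are fewer than \<mu> choices, so one \<delta> serves for all.

  Ineffability is stated for limit cardinals, so the regularity used here is itself derived from
  homogeneous sets.

  The induction on length rests on a count: an initial segment of length \<open>n\<close> and all
  but one of \<open>k\<close> further indices make \<open>n + k - 1\<close> indices, one fewer than
  the list under consideration. The omitted tuple in the definition of splitting pays for the
  induction step.\<close>

lemma card_of_finite_ordLeq: "finite A \<Longrightarrow> Cinfinite r \<Longrightarrow> |A| \<le>o r"
  by (rule ordLess_imp_ordLeq[OF Cfinite_ordLess_Cinfinite])
    (auto simp: card_of_card_order_on cfinite_def Field_card_of)

lemma card_of_lists_ordLeq:
  assumes "|A| \<le>o r" "Cinfinite r"
  shows "|lists A| \<le>o r"
proof -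
  have len: "|{xs. xs \<in> lists A \<and> length xs = n}| \<le>o r" for n
  proof (induction n)
    case 0
    have "{xs. xs \<in> lists A \<and> length xs = 0} \<subseteq> {[]}" by auto
    then show ?case
      using assms(2) by (intro card_of_finite_ordLeq) (auto dest: finite_subset)
  next
    case (Suc n)
    let ?L = "{xs. xs \<in> lists A \<and> length xs = n}"
    have "{xs. xs \<in> lists A \<and> length xs = Suc n} \<subseteq> (\<lambda>(x, xs). x # xs) ` (A \<times> ?L)"
      by (auto simp: length_Suc_conv image_iff)
    then have "|{xs. xs \<in> lists A \<and> length xs = Suc n}| \<le>o |A \<times> ?L|"
      by (rule surj_imp_ordLeq)
    also have "|A \<times> ?L| \<le>o r"
      using card_of_Times_ordLeq_infinite_Field[of r A ?L] Suc assms by (simp add: cinfinite_def)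
    finally show ?case .
  qed
  have "lists A = (\<Union>n\<in>UNIV. {xs. xs \<in> lists A \<and> length xs = n})" by auto
  moreover have "|\<Union>n\<in>(UNIV :: nat set). {xs. xs \<in> lists A \<and> length xs = n}| \<le>o r"
    using len assms(2) by (intro UNION_Cinfinite_bound)
      (auto intro: natLeq_ordLeq_cinfinite[THEN ordIso_ordLeq_trans[OF card_of_nat]])
  ultimately show ?thesis by simp
qed

text \<open>One notion of hull serves for the syntax and for Skolem hulls. Operations take lists of
  any length instead of having arities; this only enlarges the hull and does not affect the
  cardinality bound.\<close>

inductive_set generated :: "'a set \<Rightarrow> 'k set \<Rightarrow> ('k \<Rightarrow> 'a list \<Rightarrow> 'a) \<Rightarrow> 'a set"
  for S :: "'a set" and K :: "'k set" and F :: "'k \<Rightarrow> 'a list \<Rightarrow> 'a" where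
  base: "x \<in> S \<Longrightarrow> x \<in> generated S K F"
| step: "c \<in> K \<Longrightarrow> xs \<in> lists (generated S K F) \<Longrightarrow> F c xs \<in> generated S K F"

text \<open>A list has finitely many entries and so lies in a single stage \<open>st n\<close>;
  hence the hull is the union of countably many stages, each of size at most
  \<open>r\<close>.\<close>

lemma card_of_generated:
  assumes "|S| \<le>o r" "|K| \<le>o r" "Cinfinite r"
  shows "|generated S K F| \<le>o r"
proof -
  define st where "st = rec_nat S (\<lambda>_ A. A \<union> (\<lambda>(c, xs). F c xs) ` (K \<times> lists A))"
  have st0: "st 0 = S" and stS: "st (Suc n) = st n \<union> (\<lambda>(c, xs). F c xs) ` (K \<times> lists (st n))" for n
    by (simp_all add: st_def)
  have mono: "st m \<subseteq> st n" if "m \<le> n" for m n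
    using that by (induction rule: dec_induct) (auto simp: stS)
  have "|st n| \<le>o r" for n
  proof (induction n)
    case (Suc n)
    have "|(\<lambda>(c, xs). F c xs) ` (K \<times> lists (st n))| \<le>o |K \<times> lists (st n)|"
      by (rule card_of_image)
    also have "|K \<times> lists (st n)| \<le>o r"
      using card_of_Times_ordLeq_infinite_Field[of r K "lists (st n)"] assms
        card_of_lists_ordLeq[OF Suc assms(3)] by (simp add: cinfinite_def)
    finally show ?case unfolding stS using Suc assms(3) by (intro Un_Cinfinite_bound)
  qed (simp add: st0 assms)
  then have "|\<Union>n\<in>(UNIV :: nat set). st n| \<le>o r"
    using assms(3) by (intro UNION_Cinfinite_bound)
      (auto intro: natLeq_ordLeq_cinfinite[THEN ordIso_ordLeq_trans[OF card_of_nat]])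
  moreover have "generated S K F \<subseteq> (\<Union>n\<in>UNIV. st n)"
  proof
    fix x assume "x \<in> generated S K F"
    then show "x \<in> (\<Union>n\<in>UNIV. st n)"
    proof induction
      case (base x)
      then show ?case using st0 by blast
    next
      case (step c xs)
      then have "set xs \<subseteq> (\<Union>n\<in>UNIV. st n)" by auto
      then have "\<exists>n. set xs \<subseteq> st n"
      proof (induction xs)
        case (Cons x xs)
        then obtain n m where "set xs \<subseteq> st n" "x \<in> st m" by auto
        then have "set (x # xs) \<subseteq> st (max n m)"
          using mono[of n "max n m"] mono[of m "max n m"] by auto
        then show ?case by blast
      qed simp
      then obtain n where "set xs \<subseteq> st n" by blast
      then have "F c xs \<in> st (Suc n)" using step.hyps by (force simp: stS)
      then show ?case by blast
    qed
  qed
  ultimately show ?thesis by (meson card_of_mono1 ordLeq_transitive)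
qed

lemma card_of_tm:
  assumes "|UNIV :: 'f set| \<le>o r" "Cinfinite r"
  shows "|UNIV :: 'f tm set| \<le>o r"
proof -
  have "t \<in> generated (range Var) UNIV Fn" for t :: "'f tm"
    by (induction t) (auto intro: generated.intros)
  then have "(UNIV :: 'f tm set) = generated (range Var) UNIV Fn" by auto
  moreover have "|generated (range Var) UNIV (Fn :: 'f \<Rightarrow> _)| \<le>o r"
    using assms by (intro card_of_generated)
      (auto intro: ordLeq_transitive[OF card_of_image]
        natLeq_ordLeq_cinfinite[THEN ordIso_ordLeq_trans[OF card_of_nat]])
  ultimately show ?thesis by simp
qed

lemma card_of_fm:
  assumes "|UNIV :: 'f set| \<le>o r" "|UNIV :: 'r set| \<le>o r" "Cinfinite r"
  shows "|UNIV :: ('f, 'r) fm set| \<le>o r"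
proof -
  \<comment> \<open>Code 0 is negation, 1 conjunction and \<open>Suc (Suc x)\<close> quantification
    over the variable \<open>x\<close>. Lists of the wrong length give junk, which is harmless for
    an upper bound.\<close>
  define F :: "nat \<Rightarrow> ('f, 'r) fm list \<Rightarrow> ('f, 'r) fm" where
    "F c xs = (case c of 0 \<Rightarrow> Neg (xs ! 0) | Suc 0 \<Rightarrow> Conj (xs ! 0) (xs ! 1)
      | Suc (Suc x) \<Rightarrow> Ex x (xs ! 0))" for c xs
  define S :: "('f, 'r) fm set" where
    "S = (\<lambda>(s, t). Eq s t) ` (UNIV \<times> UNIV) \<union> (\<lambda>(R, ts). Rel R ts) ` (UNIV \<times> lists UNIV)"
  have F: "F 0 [\<phi>] = Neg \<phi>" "F 1 [\<phi>, \<psi>] = Conj \<phi> \<psi>" "F (Suc (Suc x)) [\<phi>] = Ex x \<phi>"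
    for \<phi> \<psi> x by (simp_all add: F_def)
  have "\<phi> \<in> generated S UNIV F" for \<phi>
  proof (induction \<phi>)
    case (Neg \<phi>)
    then show ?case using generated.step[of 0 UNIV "[\<phi>]" S F] by (simp only: F) simp
  next
    case (Conj \<phi> \<psi>)
    then show ?case using generated.step[of 1 UNIV "[\<phi>, \<psi>]" S F] by (simp only: F) simp
  next
    case (Ex x \<phi>)
    then show ?case using generated.step[of "Suc (Suc x)" UNIV "[\<phi>]" S F] by (simp only: F) simp
  qed (auto intro!: generated.base simp: S_def)
  then have "(UNIV :: ('f, 'r) fm set) = generated S UNIV F" by auto
  moreover have "|generated S UNIV F| \<le>o r"
  proof (rule card_of_generated)
    have "|(UNIV :: 'f tm set) \<times> (UNIV :: 'f tm set)| \<le>o r"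
      "|(UNIV :: 'r set) \<times> lists (UNIV :: 'f tm set)| \<le>o r"
      using card_of_Times_ordLeq_infinite_Field[OF _ card_of_tm[OF assms(1,3)] card_of_tm[OF assms(1,3)]]
        card_of_Times_ordLeq_infinite_Field[OF _ assms(2)
          card_of_lists_ordLeq[OF card_of_tm[OF assms(1,3)] assms(3)]] assms(3)
      by (auto simp: cinfinite_def)
    then show "|S| \<le>o r" unfolding S_def using assms(3)
      by (intro Un_Cinfinite_bound) (auto intro: ordLeq_transitive[OF card_of_image])
  qed (use assms in \<open>auto intro: natLeq_ordLeq_cinfinite[THEN ordIso_ordLeq_trans[OF card_of_nat]]\<close>)
  ultimately show ?thesis by simp
qed

section \<open>Satisfaction and renaming of variables\<close>

lemma finite_fv_tm [simp]: "finite (fv_tm t)"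
  by (induction t) auto

lemma finite_fv [simp]: "finite (fv \<phi>)"
  by (induction \<phi>) auto

lemma eval_tm_cong: "(\<And>x. x \<in> fv_tm t \<Longrightarrow> e x = e' x) \<Longrightarrow> eval_tm M e t = eval_tm M e' t"
proof (induction t)
  case (Fn f ts)
  have "map (eval_tm M e) ts = map (eval_tm M e') ts" using Fn by (intro map_cong) auto
  then show ?case by (simp only: eval_tm.simps)
qed simp

lemma sat_cong: "(\<And>x. x \<in> fv \<phi> \<Longrightarrow> e x = e' x) \<Longrightarrow> sat M e \<phi> \<longleftrightarrow> sat M e' \<phi>"
proof (induction \<phi> arbitrary: e e')
  case (Eq s t)
  then show ?case using eval_tm_cong[of s e e' M] eval_tm_cong[of t e e' M] by simp
next
  case (Rel R ts)
  have "map (eval_tm M e) ts = map (eval_tm M e') ts"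
    using Rel by (intro map_cong refl eval_tm_cong) auto
  then show ?case by (simp only: sat.simps)
next
  case (Neg \<phi>)
  have "sat M e \<phi> = sat M e' \<phi>" by (rule Neg.IH) (use Neg.prems in auto)
  then show ?case by simp
next
  case (Conj \<phi> \<psi>)
  have "sat M e \<phi> = sat M e' \<phi>" by (rule Conj.IH) (use Conj.prems in auto)
  moreover have "sat M e \<psi> = sat M e' \<psi>" by (rule Conj.IH) (use Conj.prems in auto)
  ultimately show ?case by simp
next
  case (Ex x \<phi>)
  have "sat M (e(x := m)) \<phi> = sat M (e'(x := m)) \<phi>" for m
    by (rule Ex.IH) (use Ex.prems in auto)
  then show ?case by simp
qed

fun ren_tm :: "(nat \<Rightarrow> nat) \<Rightarrow> 'f tm \<Rightarrow> 'f tm" where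
  "ren_tm p (Var x) = Var (p x)"
| "ren_tm p (Fn f ts) = Fn f (map (ren_tm p) ts)"

fun ren :: "(nat \<Rightarrow> nat) \<Rightarrow> ('f, 'r) fm \<Rightarrow> ('f, 'r) fm" where
  "ren p (Eq s t) = Eq (ren_tm p s) (ren_tm p t)"
| "ren p (Rel r ts) = Rel r (map (ren_tm p) ts)"
| "ren p (Neg \<phi>) = Neg (ren p \<phi>)"
| "ren p (Conj \<phi> \<psi>) = Conj (ren p \<phi>) (ren p \<psi>)"
| "ren p (Ex x \<phi>) = Ex (p x) (ren p \<phi>)"

lemma eval_tm_ren: "eval_tm M e (ren_tm p t) = eval_tm M (\<lambda>x. e (p x)) t"
  by (induction t) (auto simp: comp_def cong: map_cong)

text \<open>Bound variables are renamed as well, so that an injective renaming cannot capture variables.\<close>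

lemma sat_ren: "inj p \<Longrightarrow> sat M e (ren p \<phi>) \<longleftrightarrow> sat M (\<lambda>x. e (p x)) \<phi>"
proof (induction \<phi> arbitrary: e)
  case (Ex x \<phi>)
  then have "(\<lambda>y. (e(p x := m)) (p y)) = (\<lambda>y. e (p y))(x := m)" for m
    by (auto simp: inj_eq)
  then show ?case using Ex by simp
qed (auto simp: eval_tm_ren comp_def)

lemma fv_ren_tm: "fv_tm (ren_tm p t) = p ` fv_tm t"
  by (induction t) auto

lemma fv_ren: "inj p \<Longrightarrow> fv (ren p \<phi>) = p ` fv \<phi>"
  by (induction \<phi>) (auto simp: fv_ren_tm inj_eq)

lemma wf_ren_tm: "wf_tm L t \<Longrightarrow> wf_tm L (ren_tm p t)"
  by (induction t) auto

lemma wf_ren: "wf_fm L \<phi> \<Longrightarrow> wf_fm L (ren p \<phi>)"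
  by (induction \<phi>) (auto simp: wf_ren_tm)

section \<open>Compactness and small models\<close>

definition ultrafilter :: "'i set set \<Rightarrow> bool" where
  "ultrafilter \<U> \<longleftrightarrow> (\<forall>A B. A \<in> \<U> \<and> A \<subseteq> B \<longrightarrow> B \<in> \<U>) \<and>
    (\<forall>A\<in>\<U>. \<forall>B\<in>\<U>. A \<inter> B \<in> \<U>) \<and> (\<forall>A. - A \<in> \<U> \<longleftrightarrow> A \<notin> \<U>)"

text \<open>Zorn's lemma gives a maximal family with the finite intersection property. Maximality
  puts into it every superset of a finite intersection and one set of each complementary
  pair.\<close>

lemma ultrafilter_extends:
  assumes fip: "\<And>F. finite F \<Longrightarrow> F \<subseteq> S \<Longrightarrow> \<Inter>F \<noteq> {}"
  shows "\<exists>\<U>. ultrafilter \<U> \<and> S \<subseteq> \<U>"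
proof -
  define \<A> where "\<A> = {U. S \<subseteq> U \<and> (\<forall>F. finite F \<and> F \<subseteq> U \<longrightarrow> \<Inter>F \<noteq> {})}"
  have "\<exists>U\<in>\<A>. \<forall>X\<in>\<A>. U \<subseteq> X \<longrightarrow> X = U"
  proof (rule subset_Zorn_nonempty)
    show "\<A> \<noteq> {}" using fip unfolding \<A>_def by blast
    fix C assume C: "C \<noteq> {}" "subset.chain \<A> C"
    have "\<Inter>F \<noteq> {}" if F: "finite F" "F \<subseteq> \<Union>C" for F
    proof -
      obtain U where "U \<in> C" "F \<subseteq> U"
        using finite_subset_Union_chain[OF F C] by blast
      then show ?thesis using C F unfolding subset.chain_def \<A>_def by blast
    qed
    moreover have "S \<subseteq> \<Union>C" using C unfolding subset.chain_def \<A>_def by blast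
    ultimately show "\<Union>C \<in> \<A>" unfolding \<A>_def by blast
  qed
  then obtain U where U: "U \<in> \<A>" and max: "\<And>X. X \<in> \<A> \<Longrightarrow> U \<subseteq> X \<Longrightarrow> X = U" by blast
  have fipU: "\<Inter>F \<noteq> {}" if "finite F" "F \<subseteq> U" for F using U that unfolding \<A>_def by blast
  have up: "A \<in> U" if F: "finite F" "F \<subseteq> U" "\<Inter>F \<subseteq> A" for A F
  proof -
    have "\<Inter>G \<noteq> {}" if G: "finite G" "G \<subseteq> insert A U" for G
    proof -
      have "\<Inter>(G - {A} \<union> F) \<noteq> {}" using G F by (intro fipU) auto
      moreover have "\<Inter>(G - {A} \<union> F) \<subseteq> \<Inter>G" using F by blast
      ultimately show ?thesis by blast
    qed
    then have "insert A U \<in> \<A>" using U unfolding \<A>_def by blast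
    then show ?thesis using max by blast
  qed
  have "- A \<in> U \<longleftrightarrow> A \<notin> U" for A
  proof
    show "A \<notin> U" if "- A \<in> U" using fipU[of "{A, - A}"] that by auto
    assume "A \<notin> U"
    then have "insert A U \<notin> \<A>" using max by blast
    \<comment> \<open>Since \<open>A\<close> cannot be adjoined, finitely many members of the family
      have no common point in \<open>A\<close>; they meet inside \<open>- A\<close>.\<close>
    then obtain F where F: "finite F" "F \<subseteq> insert A U" "\<Inter>F = {}"
      using U unfolding \<A>_def by blast
    then have "\<Inter>(F - {A}) \<subseteq> - A" by blast
    moreover have "finite (F - {A})" "F - {A} \<subseteq> U" using F by auto
    ultimately show "- A \<in> U" by (intro up)
  qed
  moreover have "B \<in> U" if "A \<in> U" "A \<subseteq> B" for A B using up[of "{A}" B] that by simp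
  moreover have "A \<inter> B \<in> U" if "A \<in> U" "B \<in> U" for A B using up[of "{A, B}"] that by simp
  ultimately have "ultrafilter U" by (auto simp: ultrafilter_def)
  then show ?thesis using U unfolding \<A>_def by blast
qed

context
  fixes \<U> :: "'i set set"
  assumes uf: "ultrafilter \<U>"
begin

lemma uf_up: "A \<in> \<U> \<Longrightarrow> A \<subseteq> B \<Longrightarrow> B \<in> \<U>"
  using uf unfolding ultrafilter_def by blast

lemma uf_Int: "A \<in> \<U> \<Longrightarrow> B \<in> \<U> \<Longrightarrow> A \<inter> B \<in> \<U>"
  using uf unfolding ultrafilter_def by blast

lemma uf_Compl: "- A \<in> \<U> \<longleftrightarrow> A \<notin> \<U>"
  using uf unfolding ultrafilter_def by blast

lemma uf_UNIV: "UNIV \<in> \<U>"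
  using uf_up[of "{}" UNIV] uf_Compl[of "{}"] by auto

lemma uf_Collect_not: "{i. \<not> P i} \<in> \<U> \<longleftrightarrow> {i. P i} \<notin> \<U>"
  using uf_Compl[of "{i. P i}"] by (simp add: Compl_eq)

lemma uf_Collect_conj: "{i. P i \<and> Q i} \<in> \<U> \<longleftrightarrow> {i. P i} \<in> \<U> \<and> {i. Q i} \<in> \<U>"
  unfolding Collect_conj_eq using uf_Int uf_up[OF _ Int_lower1] uf_up[OF _ Int_lower2] by blast

lemma uf_Collect_mp: "{i. P i} \<in> \<U> \<Longrightarrow> {i. P i \<longrightarrow> Q i} \<in> \<U> \<Longrightarrow> {i. Q i} \<in> \<U>"
  using uf_Int[of "{i. P i}" "{i. P i \<longrightarrow> Q i}"]
    uf_up[of "{i. P i} \<inter> {i. P i \<longrightarrow> Q i}" "{i. Q i}"] by auto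

lemma uf_Collect_ball_finite:
  "finite A \<Longrightarrow> (\<And>x. x \<in> A \<Longrightarrow> {i. P x i} \<in> \<U>) \<Longrightarrow> {i. \<forall>x\<in>A. P x i} \<in> \<U>"
  by (induction rule: finite_induct) (auto simp: uf_UNIV uf_Collect_conj)

lemma uf_Collect_cong:
  assumes "{i. P i \<longleftrightarrow> Q i} \<in> \<U>"
  shows "{i. P i} \<in> \<U> \<longleftrightarrow> {i. Q i} \<in> \<U>"
proof -
  have "{i. P i \<longrightarrow> Q i} \<in> \<U>" "{i. Q i \<longrightarrow> P i} \<in> \<U>"
    using assms by (auto elim!: uf_up)
  then show ?thesis using uf_Collect_mp by metis
qed

text \<open>
  The points of the ultrapower are chosen representatives \<open>h g\<close> of the classes of functions \<open>g\<close>
  modulo the ultrafilter.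
\<close>

lemma ultrapower:
  fixes M :: "('f, 'r, 'm) struct"
  assumes M: "structure_of L M"
  obtains N :: "('f, 'r, 'i \<Rightarrow> 'm) struct" and h :: "('i \<Rightarrow> 'm) \<Rightarrow> 'i \<Rightarrow> 'm"
  where "structure_of L N" "\<And>g. (\<And>i. g i \<in> Dom M) \<Longrightarrow> h g \<in> Dom N"
    "\<And>e \<phi>. sat N (\<lambda>v. h (e v)) \<phi> \<longleftrightarrow> {i. sat M (\<lambda>v. e v i) \<phi>} \<in> \<U>"
proof -
  define h :: "('i \<Rightarrow> 'm) \<Rightarrow> 'i \<Rightarrow> 'm" where "h g = (SOME g'. {i. g' i = g i} \<in> \<U>)" for g
  have h: "{i. h g i = g i} \<in> \<U>" for g
    unfolding h_def by (rule someI[of _ g]) (simp add: uf_UNIV)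
  \<comment> \<open>Equivalent functions define the same predicate, so \<open>SOME\<close> picks the
    same representative. Equality in the ultrapower is therefore plain equality.\<close>
  have h_eq: "h g = h g'" if "{i. g i = g' i} \<in> \<U>" for g g'
  proof -
    have "{i. f i = g i} \<in> \<U> \<longleftrightarrow> {i. f i = g' i} \<in> \<U>" for f
      by (rule uf_Collect_cong) (use that in \<open>auto elim!: uf_up\<close>)
    then show ?thesis by (simp add: h_def)
  qed
  have h_iff: "h g = h g' \<longleftrightarrow> {i. g i = g' i} \<in> \<U>" for g g'
  proof
    assume "h g = h g'"
    then have "{i. h g i = g i \<and> h g i = g' i} \<in> \<U>" using h[of g] h[of g']
      by (simp add: uf_Collect_conj)
    then show "{i. g i = g' i} \<in> \<U>" by (rule uf_up) auto
  qed (rule h_eq)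
  define N :: "('f, 'r, 'i \<Rightarrow> 'm) struct" where
    "N = \<lparr>Dom = h ` {g. \<forall>i. g i \<in> Dom M},
      fint = (\<lambda>f xs. h (\<lambda>i. fint M f (map (\<lambda>x. x i) xs))),
      rint = (\<lambda>R xs. {i. rint M R (map (\<lambda>x. x i) xs)} \<in> \<U>)\<rparr>"
  have map_h: "{i. map (\<lambda>t. h (G t) i) ts = map (\<lambda>t. G t i) ts} \<in> \<U>"
    for G :: "'z \<Rightarrow> _" and ts
    using uf_Collect_ball_finite[of "set ts" "\<lambda>t i. h (G t) i = G t i"] h by simp
  have ev: "eval_tm N (\<lambda>v. h (e v)) t = h (\<lambda>i. eval_tm M (\<lambda>v. e v i) t)" for e t
  proof (induction t)
    case (Fn f ts)
    have "map (eval_tm N (\<lambda>v. h (e v))) ts = map (\<lambda>t. h (\<lambda>i. eval_tm M (\<lambda>v. e v i) t)) ts"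
      using Fn by simp
    then have "eval_tm N (\<lambda>v. h (e v)) (Fn f ts) =
      h (\<lambda>i. fint M f (map (\<lambda>t. h (\<lambda>i. eval_tm M (\<lambda>v. e v i) t) i) ts))"
      by (simp only: eval_tm.simps) (simp add: N_def comp_def)
    also have "\<dots> = h (\<lambda>i. fint M f (map (\<lambda>t. eval_tm M (\<lambda>v. e v i) t) ts))"
      by (rule h_eq, rule uf_up[OF map_h[of "\<lambda>t i. eval_tm M (\<lambda>v. e v i) t" ts]]) (auto simp del: map_eq_conv)
    finally show ?case by simp
  qed simp
  have los: "sat N (\<lambda>v. h (e v)) \<phi> \<longleftrightarrow> {i. sat M (\<lambda>v. e v i) \<phi>} \<in> \<U>" for e \<phi>
  proof (induction \<phi> arbitrary: e)
    case (Eq s t)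
    then show ?case by (simp add: ev h_iff)
  next
    case (Rel R ts)
    have "map (eval_tm N (\<lambda>v. h (e v))) ts = map (\<lambda>t. h (\<lambda>i. eval_tm M (\<lambda>v. e v i) t)) ts"
      by (simp add: ev)
    then have "sat N (\<lambda>v. h (e v)) (Rel R ts) \<longleftrightarrow>
      {i. rint M R (map (\<lambda>t. h (\<lambda>i. eval_tm M (\<lambda>v. e v i) t) i) ts)} \<in> \<U>"
      by (simp only: sat.simps) (simp add: N_def comp_def)
    also have "\<dots> \<longleftrightarrow> {i. rint M R (map (\<lambda>t. eval_tm M (\<lambda>v. e v i) t) ts)} \<in> \<U>"
      by (rule uf_Collect_cong, rule uf_up[OF map_h[of "\<lambda>t i. eval_tm M (\<lambda>v. e v i) t" ts]])
        (auto simp del: map_eq_conv)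
    finally show ?case by simp
  next
    case (Neg \<phi>)
    then show ?case by (simp add: uf_Collect_not)
  next
    case (Conj \<phi> \<psi>)
    then show ?case by (simp add: uf_Collect_conj)
  next
    case (Ex x \<phi>)
    have upd: "(\<lambda>v. h (e v))(x := h g) = (\<lambda>v. h ((e(x := g)) v))"
      "(\<lambda>v. (e(x := g)) v i) = (\<lambda>v. e v i)(x := g i)" for g i by auto
    have "sat N (\<lambda>v. h (e v)) (Ex x \<phi>) \<longleftrightarrow>
      (\<exists>g. (\<forall>i. g i \<in> Dom M) \<and> {i. sat M ((\<lambda>v. e v i)(x := g i)) \<phi>} \<in> \<U>)"
    proof -
      have "sat N ((\<lambda>v. h (e v))(x := h g)) \<phi> \<longleftrightarrow>
        {i. sat M ((\<lambda>v. e v i)(x := g i)) \<phi>} \<in> \<U>" for g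
        unfolding upd(1) Ex.IH upd(2) ..
      moreover have "Dom N = h ` {g. \<forall>i. g i \<in> Dom M}" by (simp add: N_def)
      ultimately show ?thesis by (auto simp del: fun_upd_apply)
    qed
    also have "\<dots> \<longleftrightarrow> {i. sat M (\<lambda>v. e v i) (Ex x \<phi>)} \<in> \<U>"
    proof
      assume "{i. sat M (\<lambda>v. e v i) (Ex x \<phi>)} \<in> \<U>"
      moreover obtain d where "d \<in> Dom M" using M unfolding structure_of_def by auto
      \<comment> \<open>Witnesses are chosen index by index; where the existential formula fails,
        \<open>d\<close> keeps the chosen function inside the domain.\<close>
      then have "\<forall>i. \<exists>m. m \<in> Dom M \<and>
        (sat M (\<lambda>v. e v i) (Ex x \<phi>) \<longrightarrow> sat M ((\<lambda>v. e v i)(x := m)) \<phi>)"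
        by auto
      then obtain g where "\<forall>i. g i \<in> Dom M \<and>
        (sat M (\<lambda>v. e v i) (Ex x \<phi>) \<longrightarrow> sat M ((\<lambda>v. e v i)(x := g i)) \<phi>)"
        by metis
      ultimately show "\<exists>g. (\<forall>i. g i \<in> Dom M) \<and> {i. sat M ((\<lambda>v. e v i)(x := g i)) \<phi>} \<in> \<U>"
        by (auto elim!: uf_up intro!: exI[of _ g])
    qed (auto elim!: uf_up)
    finally show ?case .
  qed
  have DomN: "h g \<in> Dom N" if "\<And>i. g i \<in> Dom M" for g using that by (auto simp: N_def)
  have "structure_of L N" unfolding structure_of_def
  proof (intro conjI ballI allI impI)
    obtain d where "d \<in> Dom M" using M unfolding structure_of_def by auto
    then show "Dom N \<noteq> {}" using DomN[of "\<lambda>_. d"] by auto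
  next
    fix f xs assume f: "f \<in> Funs L" "set xs \<subseteq> Dom N \<and> length xs = farity L f"
    have "\<forall>x\<in>set xs. \<exists>g. x = h g \<and> (\<forall>i. g i \<in> Dom M)" using f by (auto simp: N_def)
    then obtain G where G: "\<forall>x\<in>set xs. x = h (G x) \<and> (\<forall>i. G x i \<in> Dom M)" by metis
    have "fint N f xs = h (\<lambda>i. fint M f (map (\<lambda>x. x i) (map (\<lambda>x. h (G x)) xs)))"
      using G by (simp add: N_def cong: map_cong)
    also have "\<dots> = h (\<lambda>i. fint M f (map (\<lambda>x. G x i) xs))"
      by (rule h_eq, rule uf_up[OF map_h[of G xs]]) (auto simp: comp_def simp del: map_eq_conv)
    also have "\<dots> \<in> Dom N"
    proof (rule DomN)
      fix i
      have "set (map (\<lambda>x. G x i) xs) \<subseteq> Dom M" "length (map (\<lambda>x. G x i) xs) = farity L f"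
        using f G by auto
      then show "fint M f (map (\<lambda>x. G x i) xs) \<in> Dom M"
        using M f unfolding structure_of_def by blast
    qed
    finally show "fint N f xs \<in> Dom N" .
  qed
  then show thesis using that DomN los by blast
qed

end

section \<open>Elementary substructures and copies of bounded size\<close>

lemma downward_Lowenheim_Skolem:
  fixes N :: "('f, 'r, 'n) struct"
  assumes N: "structure_of L N" and S: "S \<subseteq> Dom N" "|S| \<le>o r"
    and r: "|UNIV :: 'f set| \<le>o r" "|UNIV :: 'r set| \<le>o r" "Cinfinite r"
  obtains H where "S \<subseteq> H" "H \<subseteq> Dom N" "|H| \<le>o r" "structure_of L (N\<lparr>Dom := H\<rparr>)"
    "\<And>e \<phi>. (\<And>v. e v \<in> H) \<Longrightarrow> sat (N\<lparr>Dom := H\<rparr>) e \<phi> \<longleftrightarrow> sat N e \<phi>"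
proof -
  obtain d where d: "d \<in> Dom N" using N unfolding structure_of_def by auto
  define F where "F c xs =
    (case c of Inl f \<Rightarrow> if f \<in> Funs L \<and> set xs \<subseteq> Dom N \<and> length xs = farity L f
        then fint N f xs else d
     | Inr (\<phi>, x) \<Rightarrow> if \<exists>m\<in>Dom N. sat_list N (xs[x := m]) \<phi>
        then SOME m. m \<in> Dom N \<and> sat_list N (xs[x := m]) \<phi> else d)"
    for c :: "'f + ('f, 'r) fm \<times> nat" and xs
  define H where "H = generated (insert d S) UNIV F"
  have SH: "S \<subseteq> H" and dH: "d \<in> H" unfolding H_def by (auto intro: generated.base)
  have FD: "F c xs \<in> Dom N" for c xs
  proof (cases c)
    case (Inl f)
    then show ?thesis using N d unfolding F_def structure_of_def by auto
  next
    case (Inr p)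
    then show ?thesis using d unfolding F_def
      by (auto split: prod.split) (metis (mono_tags, lifting) someI_ex)
  qed
  have HD: "H \<subseteq> Dom N"
  proof
    show "x \<in> Dom N" if "x \<in> H" for x
      using that unfolding H_def by (cases rule: generated.cases) (use S d FD in auto)
  qed
  have FH: "F c xs \<in> H" if "set xs \<subseteq> H" for c xs
    unfolding H_def by (rule generated.step) (use that in \<open>auto simp: H_def\<close>)
  have "|H| \<le>o r" unfolding H_def
  proof (rule card_of_generated)
    have "|{d}| \<le>o r" using r(3) by (intro card_of_finite_ordLeq) auto
    then show "|insert d S| \<le>o r"
      using Un_Cinfinite_bound[of "{d}" r S] S r(3) by simp
    have "|(UNIV :: ('f, 'r) fm set) \<times> (UNIV :: nat set)| \<le>o r"
      using card_of_fm[OF r] r(3) natLeq_ordLeq_cinfinite[OF r(3)]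
      by (intro card_of_Times_ordLeq_infinite_Field)
        (auto simp: cinfinite_def intro: ordIso_ordLeq_trans[OF card_of_nat])
    then show "|UNIV :: ('f + ('f, 'r) fm \<times> nat) set| \<le>o r"
      using r card_of_Plus_ordLeq_infinite_Field[of r "UNIV :: 'f set" "UNIV :: (('f, 'r) fm \<times> nat) set"]
      by (simp add: cinfinite_def)
  qed (use r in auto)
  moreover have "structure_of L (N\<lparr>Dom := H\<rparr>)"
    unfolding structure_of_def
  proof (intro conjI ballI allI impI)
    fix f xs assume "f \<in> Funs L" "set xs \<subseteq> Dom (N\<lparr>Dom := H\<rparr>) \<and> length xs = farity L f"
    moreover from this have "F (Inl f) xs = fint N f xs"
      using HD by (auto simp: F_def)
    ultimately show "fint (N\<lparr>Dom := H\<rparr>) f xs \<in> Dom (N\<lparr>Dom := H\<rparr>)"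
      using FH[of xs "Inl f"] by simp
  qed (use dH in auto)
  moreover have "sat (N\<lparr>Dom := H\<rparr>) e \<phi> \<longleftrightarrow> sat N e \<phi>" if "\<And>v. e v \<in> H" for e \<phi>
    using that
  proof (induction \<phi> arbitrary: e)
    have ev: "eval_tm (N\<lparr>Dom := H\<rparr>) e t = eval_tm N e t" for e t
    proof (induction t)
      case (Fn f ts)
      then have "map (eval_tm (N\<lparr>Dom := H\<rparr>) e) ts = map (eval_tm N e) ts" by simp
      then show ?case by (simp only: eval_tm.simps) simp
    qed simp
    {
      case (Eq s t)
      then show ?case by (simp add: ev)
    next
      case (Rel R ts)
      have "map (eval_tm (N\<lparr>Dom := H\<rparr>) e) ts = map (eval_tm N e) ts" by (simp add: ev)
      then show ?case by (simp only: sat.simps) simp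
    next
      case (Neg \<phi>)
      then show ?case by simp
    next
      case (Conj \<phi> \<psi>)
      then show ?case by simp
    next
      case (Ex x \<phi>)
      have "\<exists>m\<in>H. sat N (e(x := m)) \<phi>" if m: "m \<in> Dom N" "sat N (e(x := m)) \<phi>" for m
      proof -
        \<comment> \<open>The list has to be longer than \<open>x\<close>, since otherwise
          \<open>xs[x := m']\<close> would equal \<open>xs\<close>, and it has to cover the free
          variables of \<phi>.\<close>
        define n where "n = Suc (Max (insert x (fv \<phi>)))"
        define xs where "xs = map e [0..<n]"
        have lt: "v < n" if "v \<in> insert x (fv \<phi>)" for v
          using that unfolding n_def by (simp only: less_Suc_eq_le) (intro Max_ge, auto)
        have xs: "sat_list N (xs[x := m']) \<phi> \<longleftrightarrow> sat N (e(x := m')) \<phi>" for m'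
          by (rule sat_cong) (use lt in \<open>auto simp: xs_def nth_list_update\<close>)
        have ex: "\<exists>m\<in>Dom N. sat_list N (xs[x := m]) \<phi>" using m xs by blast
        let ?w = "F (Inr (\<phi>, x)) xs"
        have "?w = (SOME m. m \<in> Dom N \<and> sat_list N (xs[x := m]) \<phi>)"
          using ex by (simp add: F_def)
        then have "sat_list N (xs[x := ?w]) \<phi>"
          using ex someI_ex[of "\<lambda>m. m \<in> Dom N \<and> sat_list N (xs[x := m]) \<phi>"] by auto
        moreover have "?w \<in> H" by (rule FH) (use Ex.prems in \<open>auto simp: xs_def\<close>)
        ultimately show ?thesis using xs by blast
      qed
      moreover have "sat (N\<lparr>Dom := H\<rparr>) (e(x := m)) \<phi> \<longleftrightarrow> sat N (e(x := m)) \<phi>" if "m \<in> H" for m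
        by (rule Ex.IH) (use that Ex.prems in auto)
      ultimately show ?case using HD by auto
    }
  qed
  ultimately show thesis using that SH HD by blast
qed

text \<open>Well-formedness matters: it keeps the values of terms in the domain, and only there does
  \<open>g\<close> invert \<open>h\<close>.\<close>

lemma transport_structure:
  fixes N :: "('f, 'r, 'n) struct" and h :: "'n \<Rightarrow> 'u"
  assumes N: "structure_of L N" and h: "inj_on h (Dom N)"
  shows "\<exists>N' :: ('f, 'r, 'u) struct. structure_of L N' \<and> Dom N' = h ` Dom N \<and>
    (\<forall>e \<phi>. \<phi> \<in> formulas L \<and> (\<forall>v. e v \<in> Dom N) \<longrightarrow>
      (sat N' (\<lambda>v. h (e v)) \<phi> \<longleftrightarrow> sat N e \<phi>))"
proof -
  define g where "g = inv_into (Dom N) h"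
  have gh: "g (h x) = x" if "x \<in> Dom N" for x using that h by (simp add: g_def)
  define N' :: "('f, 'r, 'u) struct" where
    "N' = \<lparr>Dom = h ` Dom N, fint = (\<lambda>f xs. h (fint N f (map g xs))),
      rint = (\<lambda>R xs. rint N R (map g xs))\<rparr>"
  have fD: "fint N f xs \<in> Dom N" if "f \<in> Funs L" "set xs \<subseteq> Dom N" "length xs = farity L f" for f xs
    using N that unfolding structure_of_def by blast
  have ev: "eval_tm N e t \<in> Dom N \<and> eval_tm N' (\<lambda>v. h (e v)) t = h (eval_tm N e t)"
    if "wf_tm L t" "\<And>v. e v \<in> Dom N" for e t
    using that
  proof (induction t)
    case (Fn f ts)
    then have "map g (map (eval_tm N' (\<lambda>v. h (e v))) ts) = map (eval_tm N e) ts"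
      by (auto simp: gh)
    then have "eval_tm N' (\<lambda>v. h (e v)) (Fn f ts) = h (fint N f (map (eval_tm N e) ts))"
      by (simp add: N'_def del: map_map)
    moreover have "fint N f (map (eval_tm N e) ts) \<in> Dom N"
      by (rule fD) (use Fn in auto)
    ultimately show ?case by simp
  qed simp
  have "sat N' (\<lambda>v. h (e v)) \<phi> \<longleftrightarrow> sat N e \<phi>"
    if "wf_fm L \<phi>" "\<And>v. e v \<in> Dom N" for e \<phi>
    using that
  proof (induction \<phi> arbitrary: e)
    case (Eq s t)
    then show ?case using ev[of s e] ev[of t e] h by (auto simp: inj_on_eq_iff)
  next
    case (Rel R ts)
    then have "map g (map (eval_tm N' (\<lambda>v. h (e v))) ts) = map (eval_tm N e) ts"
      using ev by (auto simp: gh)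
    then show ?case by (simp add: N'_def del: map_map)
  next
    case (Ex x \<phi>)
    have "(\<lambda>v. h (e v))(x := h m) = (\<lambda>v. h ((e(x := m)) v))" for m by auto
    moreover have "sat N' (\<lambda>v. h ((e(x := m)) v)) \<phi> \<longleftrightarrow> sat N (e(x := m)) \<phi>"
      if "m \<in> Dom N" for m using that Ex by (intro Ex.IH) auto
    moreover have "Dom N' = h ` Dom N" by (simp add: N'_def)
    ultimately show ?case by simp
  qed auto
  moreover have "structure_of L N'" unfolding structure_of_def
  proof (intro conjI ballI allI impI)
    show "Dom N' \<noteq> {}" using N by (auto simp: N'_def structure_of_def)
    fix f xs assume f: "f \<in> Funs L" "set xs \<subseteq> Dom N' \<and> length xs = farity L f"
    then have "fint N f (map g xs) \<in> Dom N"
      by (intro fD) (auto simp: N'_def gh)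
    then show "fint N' f xs \<in> Dom N'" by (simp add: N'_def)
  qed
  moreover have "Dom N' = h ` Dom N" by (simp add: N'_def)
  ultimately show ?thesis unfolding formulas_def by (intro exI[of _ N']) simp
qed

text \<open>Compactness in the form used below: what holds in \<open>M\<close> at almost every index
  holds in one model whose points lie in \<open>'u\<close>. It is the ultrapower, cut down to a hull
  of the chosen points and copied along an injection.\<close>

lemma realize_in_small_model:
  fixes M :: "('f, 'r, 'm) struct" and x :: "'j \<Rightarrow> 'i \<Rightarrow> 'm"
  assumes M: "structure_of L M" and uf: "ultrafilter \<U>"
    and J: "|J| \<le>o r" and x: "\<And>j i. j \<in> J \<Longrightarrow> x j i \<in> Dom M"
    and r: "|UNIV :: 'f set| \<le>o r" "|UNIV :: 'r set| \<le>o r" "Cinfinite r"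
      "r \<le>o |UNIV :: 'u set|"
  shows "\<exists>(N :: ('f, 'r, 'u) struct) (y :: 'j \<Rightarrow> 'u). structure_of L N \<and> y ` J \<subseteq> Dom N \<and>
    (\<forall>\<phi> js. \<phi> \<in> formulas L \<longrightarrow> set js \<subseteq> J \<longrightarrow> fv \<phi> \<subseteq> {..<length js} \<longrightarrow>
      (sat_list N (map y js) \<phi> \<longleftrightarrow> {i. sat_list M (map (\<lambda>j. x j i) js) \<phi>} \<in> \<U>))"
proof -
  obtain P :: "('f, 'r, 'i \<Rightarrow> 'm) struct" and h where P: "structure_of L P"
    "\<And>g. (\<And>i. g i \<in> Dom M) \<Longrightarrow> h g \<in> Dom P"
    "\<And>e \<phi>. sat P (\<lambda>v. h (e v)) \<phi> \<longleftrightarrow> {i. sat M (\<lambda>v. e v i) \<phi>} \<in> \<U>"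
    using ultrapower[OF uf M] by metis
  have "(\<lambda>j. h (x j)) ` J \<subseteq> Dom P" using P(2) x by blast
  moreover have "|(\<lambda>j. h (x j)) ` J| \<le>o r" using J by (meson card_of_image ordLeq_transitive)
  ultimately obtain H where H: "(\<lambda>j. h (x j)) ` J \<subseteq> H" "H \<subseteq> Dom P" "|H| \<le>o r"
    "structure_of L (P\<lparr>Dom := H\<rparr>)"
    "\<And>e \<phi>. (\<And>v. e v \<in> H) \<Longrightarrow> sat (P\<lparr>Dom := H\<rparr>) e \<phi> \<longleftrightarrow> sat P e \<phi>"
    using downward_Lowenheim_Skolem[OF P(1) _ _ r(1-3)] by metis
  have "|H| \<le>o |UNIV :: 'u set|" using H(3) r(4) by (rule ordLeq_transitive)
  then obtain g :: "_ \<Rightarrow> 'u" where g: "inj_on g H" using card_of_ordLeq[of H "UNIV :: 'u set"] by auto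
  then have "inj_on g (Dom (P\<lparr>Dom := H\<rparr>))" by simp
  then obtain N :: "('f, 'r, 'u) struct" where N: "structure_of L N" "Dom N = g ` H"
    "\<forall>e \<phi>. \<phi> \<in> formulas L \<and> (\<forall>v. e v \<in> H) \<longrightarrow>
      (sat N (\<lambda>v. g (e v)) \<phi> \<longleftrightarrow> sat (P\<lparr>Dom := H\<rparr>) e \<phi>)"
    using transport_structure[OF H(4), of g] by auto
  obtain d where d: "d \<in> H" using H(4) by (auto simp: structure_of_def)
  have "sat_list N (map (\<lambda>j. g (h (x j))) js) \<phi> \<longleftrightarrow>
      {i. sat_list M (map (\<lambda>j. x j i) js) \<phi>} \<in> \<U>"
    if \<phi>: "\<phi> \<in> formulas L" "fv \<phi> \<subseteq> {..<length js}" and js: "set js \<subseteq> J" for \<phi> js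
  proof -
    define e where "e v = (if v < length js then h (x (js ! v)) else d)" for v
    have eH: "e v \<in> H" for v
      using H(1) d js nth_mem[of v js] by (auto simp: e_def image_subset_iff subset_iff)
    have "sat_list N (map (\<lambda>j. g (h (x j))) js) \<phi> \<longleftrightarrow> sat N (\<lambda>v. g (e v)) \<phi>"
      by (rule sat_cong) (use \<phi> in \<open>auto simp: e_def\<close>)
    also have "\<dots> \<longleftrightarrow> sat P e \<phi>" using N(3) \<phi>(1) eH H(5)[OF eH] by simp
    also have "\<dots> \<longleftrightarrow> sat P (\<lambda>v. h (x (js ! v))) \<phi>"
      by (rule sat_cong) (use \<phi> in \<open>auto simp: e_def\<close>)
    also have "\<dots> \<longleftrightarrow> {i. sat M (\<lambda>v. x (js ! v) i) \<phi>} \<in> \<U>" by (rule P(3))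
    also have "(\<lambda>i. sat M (\<lambda>v. x (js ! v) i) \<phi>) = (\<lambda>i. sat_list M (map (\<lambda>j. x j i) js) \<phi>)"
      by (intro ext sat_cong) (use \<phi> in auto)
    finally show ?thesis .
  qed
  moreover have "(\<lambda>j. g (h (x j))) ` J \<subseteq> Dom N" using H(1) N(2) by blast
  ultimately show ?thesis using N(1)
    by (intro exI[of _ N] exI[of _ "\<lambda>j. g (h (x j))"] conjI allI impI)
qed

section \<open>Splitting patterns\<close>

lemma same_type_over_iff:
  "same_type_over L M D b b' \<longleftrightarrow> length b = length b' \<and>
    (\<forall>\<psi> s d. \<psi> \<in> formulas L \<and> set s \<subseteq> {..<length b} \<and> set d \<subseteq> D \<and>
      fv \<psi> \<subseteq> {..<length s + length d} \<longrightarrow>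
      (sat_list M (map ((!) b) s @ d) \<psi> \<longleftrightarrow> sat_list M (map ((!) b') s @ d) \<psi>))"
proof (cases "length b = length b'")
  case True
  then show ?thesis unfolding same_type_over_def tp_def set_eq_iff by auto
qed (simp add: same_type_over_def)

lemma same_type_over_mono:
  "same_type_over L M D b b' \<Longrightarrow> C \<subseteq> D \<Longrightarrow> same_type_over L M C b b'"
  unfolding same_type_over_iff by (meson order_trans)

text \<open>A chain of splitting witnesses for one fixed realization \<open>a\<close>. All earlier
  pairs belong to the base of pair \<open>i\<close>, so a base contained in an initial segment of
  the pairs is split over by the next one.\<close>

definition k_pattern ::
  "('f, 'r) language \<Rightarrow> ('f, 'r, 'm) struct \<Rightarrow> nat \<Rightarrow> nat \<Rightarrow> nat \<Rightarrow> ('f, 'r) fm \<Rightarrow> nat \<Rightarrow>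
    'm list list \<Rightarrow> (nat \<Rightarrow> 'm list) \<Rightarrow> (nat \<Rightarrow> 'm list) \<Rightarrow> bool" where
  "k_pattern L M k n m \<phi> N a b b' \<longleftrightarrow>
    length a = k \<and> (\<forall>x\<in>set a. length x = n \<and> set x \<subseteq> Dom M) \<and>
    (\<forall>i<N. length (b i) = m \<and> length (b' i) = m \<and> set (b i) \<subseteq> Dom M \<and> set (b' i) \<subseteq> Dom M \<and>
      sat_list M (concat a @ b i) \<phi> \<and> \<not> sat_list M (concat a @ b' i) \<phi> \<and>
      (\<forall>r<k. same_type_over L M
        ((\<Union>j<i. set (b j) \<union> set (b' j)) \<union> (\<Union>j\<in>{..<k} - {r}. set (a ! j))) (b i) (b' i)))"

text \<open>
  Compactness stretches patterns of all finite lengths to one whose length is a successor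
  cardinal above \<open>\<lambda>\<close>. By regularity, every \<open>C\<close> of size less than \<open>\<lambda>\<close> in the parameters of the long pattern is contained in a
  proper initial segment of it, and the next pair witnesses splitting over \<open>C\<close>.
\<close>

theorem no_long_k_patterns:
  fixes L :: "('f, 'r) language" and M :: "('f, 'r, 'm) struct"
  assumes bounded: "bounded_k_splitting TYPE('l) L T k" and T: "T \<subseteq> sentences L"
    and M: "is_model L T M" and \<phi>: "\<phi> \<in> formulas L" "fv \<phi> \<subseteq> {..<k * n + m}"
  shows "\<exists>N. \<forall>a b b'. \<not> k_pattern L M k n m \<phi> N a b b'"
proof (rule ccontr)
  assume "\<not> ?thesis"
  then obtain a b b' where pat: "\<And>N. k_pattern L M k n m \<phi> N (a N) (b N) (b' N)" by metis
  have strM: "structure_of L M" using M by (simp add: is_model_def)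
  then obtain d0 where d0: "d0 \<in> Dom M" by (auto simp: structure_of_def)
  let ?u = "|UNIV :: ('l + 'f + 'r + nat) set|"
  \<comment> \<open>The order \<lambda> lives on \<open>'l\<close>, so it is at most
    \<open>?u\<close>; the successor \<kappa> is regular and exceeds the size of every candidate for
    \<open>C\<close>.\<close>
  define \<kappa> where "\<kappa> = cardSuc ?u"
  have inf_u: "infinite (UNIV :: ('l + 'f + 'r + nat) set)"
    by (simp add: finite_prod)
  have u: "Cinfinite ?u" using inf_u by (simp add: cinfinite_def Field_card_of card_of_card_order_on)
  have \<kappa>: "Cinfinite \<kappa>" unfolding \<kappa>_def by (rule Cinfinite_cardSuc[OF u])
  interpret \<kappa>: wo_rel \<kappa> using \<kappa> by (simp add: wo_rel_def card_order_on_def)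
  have u\<kappa>: "?u \<le>o \<kappa>" unfolding \<kappa>_def by (rule cardSuc_ordLeq) (rule card_of_Card_order)
  define ok where "ok E F \<longleftrightarrow> finite F \<and> F \<subseteq> Field \<kappa> \<and> E \<subseteq> F" for E F
  have "\<exists>\<U>. ultrafilter \<U> \<and> (\<lambda>c. {F. ok {c} F}) ` Field \<kappa> \<subseteq> \<U>"
  proof (rule ultrafilter_extends)
    fix G assume "finite G" "G \<subseteq> (\<lambda>c. {F. ok {c} F}) ` Field \<kappa>"
    then obtain E where "E \<subseteq> Field \<kappa>" "finite E" "G = (\<lambda>c. {F. ok {c} F}) ` E"
      by (meson finite_subset_image)
    then have "E \<in> \<Inter>G" by (auto simp: ok_def)
    then show "\<Inter>G \<noteq> {}" by blast
  qed
  then obtain \<U> where uf: "ultrafilter \<U>"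
    and "(\<lambda>c. {F. ok {c} F}) ` Field \<kappa> \<subseteq> \<U>" by (elim exE conjE)
  then have c\<U>: "{F. ok {c} F} \<in> \<U>" if "c \<in> Field \<kappa>" for c
    using that by (simp add: image_subset_iff)
  have ok\<U>: "{F. ok E F} \<in> \<U>" if "finite E" "E \<subseteq> Field \<kappa>" "E \<noteq> {}" for E
  proof -
    have "{F. \<forall>c\<in>E. ok {c} F} \<in> \<U>"
      by (rule uf_Collect_ball_finite[OF uf that(1)]) (use c\<U> that(2) in blast)
    then show ?thesis by (rule uf_up[OF uf]) (use that in \<open>auto simp: ok_def\<close>)
  qed
  define pos where "pos F c = card (F \<inter> underS \<kappa> c)" for F c
  have pos_less: "pos F c < pos F c'" if "finite F" "c \<in> F" "c \<in> underS \<kappa> c'" for F c c'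
  proof -
    have "F \<inter> underS \<kappa> c \<subset> F \<inter> underS \<kappa> c'"
      using that underS_incr[OF \<kappa>.TRANS \<kappa>.ANTISYM, of c c'] by (auto simp: underS_def)
    then show ?thesis unfolding pos_def using that by (intro psubset_card_mono) auto
  qed
  have pos_card: "pos F c < card F" if "finite F" "c \<in> F" for F c
    unfolding pos_def using that by (intro psubset_card_mono) (auto simp: underS_def)
  define bb where "bb s = (if s then b else b')" for s
  \<comment> \<open>The default \<open>d0\<close> appears only where \<open>ok {c} F\<close> fails,
    a negligible set of indices for \<open>c\<close> in \<kappa>.\<close>
  define x where "x j F = (case j of Inl (p, t) \<Rightarrow> a (card F) ! p ! t
    | Inr (c, s, t) \<Rightarrow> if ok {c} F then bb s (card F) (pos F c) ! t else d0)"
    for j :: "nat \<times> nat + ('l + 'f + 'r + nat) set \<times> bool \<times> nat" and F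
  define J where "J = ({..<k} \<times> {..<n}) <+> (Field \<kappa> \<times> (UNIV :: bool set) \<times> {..<m})"
  have length_a: "length (a N) = k" for N using pat[of N] unfolding k_pattern_def by blast
  have len_a: "length (a N ! p) = n" "set (a N ! p) \<subseteq> Dom M" if "p < k" for N p
    using pat[of N] that unfolding k_pattern_def by auto
  have len_b: "length (bb s N i) = m" "set (bb s N i) \<subseteq> Dom M" if "i < N" for s N i
    using pat[of N] that unfolding k_pattern_def bb_def by auto
  have a_D: "a N ! p ! t \<in> Dom M" if "p < k" "t < n" for N p t
    using len_a[OF that(1), of N] that(2) nth_mem[of t "a N ! p"] by auto
  have b_D: "bb s N i ! t \<in> Dom M" if "i < N" "t < m" for s N i t
    using len_b[OF that(1), of s] that(2) nth_mem[of t "bb s N i"] by auto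
  have xD: "x j F \<in> Dom M" if "j \<in> J" for j F
  proof (cases j)
    case (Inl q)
    obtain p t where "q = (p, t)" by (cases q)
    then show ?thesis using that Inl a_D by (auto simp: J_def x_def)
  next
    case (Inr q)
    obtain c s t where q: "q = (c, s, t)" by (cases q)
    show ?thesis
    proof (cases "ok {c} F")
      case True
      then have "pos F c < card F" using pos_card by (auto simp: ok_def)
      then show ?thesis using that Inr q True b_D by (auto simp: J_def x_def)
    qed (use Inr q d0 in \<open>simp add: x_def\<close>)
  qed
  have J\<kappa>: "|J| \<le>o \<kappa>"
  proof -
    have inf: "infinite (Field \<kappa>)" "Card_order \<kappa>" using \<kappa> by (auto simp: cinfinite_def)
    have "|Field \<kappa>| \<le>o \<kappa>" using inf(2) by (metis card_of_Field_ordIso ordIso_imp_ordLeq)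
    then show ?thesis unfolding J_def using inf
      by (intro card_of_Plus_ordLeq_infinite_Field card_of_Times_ordLeq_infinite_Field)
        (auto intro: card_of_finite_ordLeq[OF _ \<kappa>])
  qed
  have inl: "|UNIV :: 'f set| \<le>o \<kappa>" "|UNIV :: 'r set| \<le>o \<kappa>"
  proof -
    have "|UNIV :: 'f set| \<le>o ?u" "|UNIV :: 'r set| \<le>o ?u"
      by (intro card_of_ordLeqI[of "\<lambda>f. Inr (Inl f)"] card_of_ordLeqI[of "\<lambda>f. Inr (Inr (Inl f))"],
          auto simp: inj_def)+
    then show "|UNIV :: 'f set| \<le>o \<kappa>" "|UNIV :: 'r set| \<le>o \<kappa>"
      using u\<kappa> ordLeq_transitive by blast+
  qed
  \<comment> \<open>As a \<open>cardSuc\<close>, \<kappa> is an order on sets of elements of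
    \<open>'l + 'f + 'r + nat\<close>. Such sets are the points of the models in the hypothesis, so
    the long pattern fits there.\<close>
  have "\<kappa> \<le>o |UNIV :: ('l + 'f + 'r + nat) set set|"
    using \<kappa> by (metis card_of_Field_ordIso card_of_mono1 ordIso_ordLeq_trans ordIso_symmetric subset_UNIV)
  then have "\<exists>(N :: ('f, 'r, ('l + 'f + 'r + nat) set) struct) y. structure_of L N \<and>
    y ` J \<subseteq> Dom N \<and> (\<forall>\<psi> js. \<psi> \<in> formulas L \<longrightarrow> set js \<subseteq> J \<longrightarrow> fv \<psi> \<subseteq> {..<length js} \<longrightarrow>
      (sat_list N (map y js) \<psi> \<longleftrightarrow> {i. sat_list M (map (\<lambda>j. x j i) js) \<psi>} \<in> \<U>))"
    by (intro realize_in_small_model[OF strM uf J\<kappa> xD inl \<kappa>])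
  then obtain N :: "('f, 'r, ('l + 'f + 'r + nat) set) struct" and y where N: "structure_of L N"
    "y ` J \<subseteq> Dom N"
    "\<forall>\<psi> js. \<psi> \<in> formulas L \<longrightarrow> set js \<subseteq> J \<longrightarrow> fv \<psi> \<subseteq> {..<length js} \<longrightarrow>
      (sat_list N (map y js) \<psi> \<longleftrightarrow> {i. sat_list M (map (\<lambda>j. x j i) js) \<psi>} \<in> \<U>)"
    by (elim exE conjE)
  note N_sat = N(3)[rule_format]
  have modN: "is_model L T N" unfolding is_model_def
  proof (intro conjI ballI N(1))
    fix \<theta> assume "\<theta> \<in> T"
    then have "\<theta> \<in> formulas L" "fv \<theta> = {}" "sat_list M [] \<theta>"
      using T M by (auto simp: sentences_def is_model_def)
    then show "sat_list N [] \<theta>" using N_sat[of \<theta> "[]"] uf_UNIV[OF uf] by simp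
  qed
  define as :: "(nat \<times> nat + ('l + 'f + 'r + nat) set \<times> bool \<times> nat) list"
    where "as = concat (map (\<lambda>p. map (\<lambda>t. Inl (p, t)) [0..<n]) [0..<k])"
  define ya where "ya = map (\<lambda>p. map (\<lambda>t. y (Inl (p, t))) [0..<n]) [0..<k]"
  define yb where "yb c s = map (\<lambda>t. y (Inr (c, s, t))) [0..<m]" for c s
  define bs :: "('l + 'f + 'r + nat) set \<Rightarrow> bool \<Rightarrow>
    (nat \<times> nat + ('l + 'f + 'r + nat) set \<times> bool \<times> nat) list" where "bs c s = map (\<lambda>t. Inr (c, s, t)) [0..<m]" for c s
  have ya_as: "concat ya = map y as"
    by (simp add: ya_def as_def map_concat comp_def)
  have yb_bs: "yb c s = map y (bs c s)" for c s by (simp add: yb_def bs_def)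
  have len_as: "length as = k * n" by (simp add: as_def length_concat comp_def sum_list_triv)
  have as_J: "set as \<subseteq> J" by (auto simp: as_def J_def)
  have bs_J: "set (bs c s) \<subseteq> J" if "c \<in> Field \<kappa>" for c s using that by (auto simp: bs_def J_def)
  have x_as: "map (\<lambda>j. x j F) as = concat (a (card F))" for F
  proof -
    have "map (\<lambda>p. map (\<lambda>t. a (card F) ! p ! t) [0..<n]) [0..<k] = a (card F)"
      using len_a(1) length_a by (intro nth_equalityI) (auto intro: nth_equalityI)
    then show ?thesis by (simp add: as_def map_concat comp_def x_def)
  qed
  have x_bs: "map (\<lambda>j. x j F) (bs c s) = bb s (card F) (pos F c)" if "ok {c} F" for F c s
    using that len_b[of "pos F c" "card F" s] pos_card[of F c]
    by (intro nth_equalityI) (auto simp: bs_def x_def ok_def)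
  define B where "B = (\<Union>c\<in>Field \<kappa>. \<Union>s. set (yb c s))"
  have yb_B: "set (yb c s) \<subseteq> B" if "c \<in> Field \<kappa>" for c s using that by (auto simp: B_def)
  have "B \<subseteq> Dom N" using N(2) bs_J by (force simp: B_def yb_bs)
  moreover have "\<forall>z\<in>set ya. length z = n \<and> set z \<subseteq> Dom N"
    using N(2) by (force simp: ya_def J_def)
  moreover have "length ya = k" by (simp add: ya_def)
  ultimately obtain lam :: "'l rel" and C where lam: "Card_order lam"
    and C: "C \<subseteq> B" "|C| <o lam" "\<not> k_splits L N ya B C"
    using bounded modN unfolding bounded_k_splitting_def lambda_bounded_k_splitting_def by blast
  have "lam \<le>o ?u"
  proof -
    have "lam =o |Field lam|" using lam card_of_Field_ordIso ordIso_symmetric by blast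
    also have "|Field lam| \<le>o ?u" by (intro card_of_ordLeqI[of Inl]) auto
    finally show ?thesis .
  qed
  then have C_u: "|C| \<le>o ?u" using C(2) by (meson ordLess_imp_ordLeq ordLeq_transitive)
  define As where "As c = (\<Union>c'\<in>under \<kappa> c. \<Union>s. set (yb c' s))" for c
  have "relChain (cardSuc ?u) As" unfolding relChain_def
    using \<kappa>.TRANS by (auto simp: As_def under_def \<kappa>_def trans_def)
  moreover have "B \<subseteq> (\<Union>c\<in>Field (cardSuc ?u). As c)"
    using \<kappa>.REFL by (auto simp: B_def As_def \<kappa>_def under_def refl_on_def)
  ultimately obtain c where c: "c \<in> Field \<kappa>" "C \<subseteq> As c"
    using cardSuc_UNION_Cinfinite[OF u, of As C] C(1) C_u unfolding \<kappa>_def by blast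
  have "\<exists>c1\<in>Field \<kappa>. c \<noteq> c1 \<and> (c, c1) \<in> \<kappa>"
    by (rule infinite_Card_order_limit) (use \<kappa> c in \<open>auto simp: cinfinite_def\<close>)
  then obtain c1 where c1: "c1 \<in> Field \<kappa>" "c \<noteq> c1" "(c, c1) \<in> \<kappa>" by blast
  have "under \<kappa> c \<subseteq> underS \<kappa> c1"
    using c1 transD[OF \<kappa>.TRANS, of _ c c1] antisymD[OF \<kappa>.ANTISYM, of c c1]
    by (auto simp: under_def underS_def)
  then have C_sub: "C \<subseteq> (\<Union>c'\<in>underS \<kappa> c1. \<Union>s. set (yb c' s))" using c(2) unfolding As_def by blast
  have "same_type_over L N (C \<union> (\<Union>j\<in>{..<k} - {p}. set (ya ! j))) (yb c1 True) (yb c1 False)"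
    if p: "p < k" for p
    unfolding same_type_over_iff
  proof (intro conjI allI impI; (elim conjE)?)
    show "length (yb c1 True) = length (yb c1 False)" by (simp add: yb_def)
    fix \<psi> s d
    assume \<psi>: "\<psi> \<in> formulas L" "fv \<psi> \<subseteq> {..<length s + length d}"
      and s: "set s \<subseteq> {..<length (yb c1 True)}"
      and d: "set d \<subseteq> C \<union> (\<Union>j\<in>{..<k} - {p}. set (ya ! j))"
    let ?D = "(({..<k} - {p}) \<times> {..<n}) <+> (underS \<kappa> c1 \<times> UNIV \<times> {..<m})"
    have "set d \<subseteq> y ` ?D" using d C_sub by (force simp: ya_def yb_def)
    then have "d \<in> lists (y ` ?D)" by blast
    then obtain ds where ds: "set ds \<subseteq> ?D" "d = map y ds" unfolding lists_image by auto
    have s_m: "set s \<subseteq> {..<m}" using s by (simp add: yb_def)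
    define ss :: "bool \<Rightarrow> (nat \<times> nat + ('l + 'f + 'r + nat) set \<times> bool \<times> nat) list"
      where "ss q = map (\<lambda>t. Inr (c1, q, t)) s" for q
    have ybs: "map ((!) (yb c1 q)) s @ d = map y (ss q @ ds)" for q
      using s_m by (auto simp: yb_def ss_def ds)
    have D_J: "?D \<subseteq> J" by (auto simp: J_def dest: underS_Field)
    have ss_J: "set (ss q @ ds) \<subseteq> J" for q
      using s_m c1 ds D_J by (auto simp: ss_def J_def)
    have fv: "fv \<psi> \<subseteq> {..<length (ss q @ ds)}" for q using \<psi> by (simp add: ss_def ds)
    \<comment> \<open>Only finitely many points of \<kappa> occur in the formula and its parameters.
      For every \<open>F\<close> containing them, the finite pattern at \<open>F\<close> gives the
      equivalence in \<open>M\<close>.\<close>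
    define E where "E = insert c1 {c. \<exists>z. Inr (c, z) \<in> set ds}"
    have "{c. \<exists>z. Inr (c, z) \<in> set ds} \<subseteq> (\<lambda>j. case j of Inr (c, z) \<Rightarrow> c | _ \<Rightarrow> c1) ` set ds"
      by force
    then have "finite E" unfolding E_def by (meson finite.insertI finite_imageI finite_set finite_subset)
    moreover have "E \<subseteq> Field \<kappa>" using ds c1 by (auto simp: E_def dest: underS_Field)
    ultimately have E: "{F. ok E F} \<in> \<U>" by (intro ok\<U>) (auto simp: E_def)
    have "sat_list M (map (\<lambda>j. x j F) (ss True @ ds)) \<psi> \<longleftrightarrow>
      sat_list M (map (\<lambda>j. x j F) (ss False @ ds)) \<psi>" if F: "ok E F" for F
    proof -
      let ?N = "card F" and ?i = "pos F c1"
      have okc: "ok {c} F" if "c \<in> E" for c using F that by (auto simp: ok_def)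
      then have okc1: "ok {c1} F" by (auto simp: E_def)
      then have i: "?i < ?N" using pos_card by (auto simp: ok_def)
      have "same_type_over L M ((\<Union>j<?i. set (b ?N j) \<union> set (b' ?N j)) \<union>
          (\<Union>j\<in>{..<k} - {p}. set (a ?N ! j))) (b ?N ?i) (b' ?N ?i)"
        using pat[of ?N] i p unfolding k_pattern_def by blast
      moreover have "set (map (\<lambda>j. x j F) ds) \<subseteq> (\<Union>j<?i. set (b ?N j) \<union> set (b' ?N j)) \<union>
          (\<Union>j\<in>{..<k} - {p}. set (a ?N ! j))"
      proof
        fix z assume "z \<in> set (map (\<lambda>j. x j F) ds)"
        then obtain j where j: "j \<in> set ds" "z = x j F" by auto
        then have "j \<in> ?D" using ds by blast
        then show "z \<in> (\<Union>j<?i. set (b ?N j) \<union> set (b' ?N j)) \<union> (\<Union>j\<in>{..<k} - {p}. set (a ?N ! j))"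
        proof (cases j)
          case (Inl q)
          then obtain l t where "q = (l, t)" "l < k" "l \<noteq> p" "t < n" using \<open>j \<in> ?D\<close> by auto
          then show ?thesis using Inl j len_a(1)[of l ?N] by (force simp: x_def)
        next
          case (Inr q)
          then obtain c l t where q: "q = (c, l, t)" "c \<in> underS \<kappa> c1" "t < m"
            using \<open>j \<in> ?D\<close> by auto
          then have "c \<in> E" using Inr j by (auto simp: E_def)
          then have "ok {c} F" by (rule okc)
          then have "pos F c < ?i" "z = bb l ?N (pos F c) ! t"
            using q Inr j pos_less by (auto simp: x_def ok_def)
          moreover from this have "z \<in> set (bb l ?N (pos F c))"
            using len_b[of "pos F c" ?N l] i q by simp
          ultimately show ?thesis by (auto simp: bb_def split: if_splits)
        qed
      qed
      moreover have "map (\<lambda>j. x j F) (ss q) = map ((!) (bb q ?N ?i)) s" for q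
        using okc1 by (simp add: ss_def x_def)
      moreover have "length (b ?N ?i) = m" using len_b(1)[OF i, of True] by (simp add: bb_def)
      ultimately show ?thesis using \<psi> s_m ds unfolding same_type_over_iff
        by (simp add: bb_def)
    qed
    then have "{F. sat_list M (map (\<lambda>j. x j F) (ss True @ ds)) \<psi> \<longleftrightarrow>
      sat_list M (map (\<lambda>j. x j F) (ss False @ ds)) \<psi>} \<in> \<U>"
      by (intro uf_up[OF uf E]) blast
    then show "sat_list N (map ((!) (yb c1 True)) s @ d) \<psi> \<longleftrightarrow>
      sat_list N (map ((!) (yb c1 False)) s @ d) \<psi>"
      unfolding ybs N_sat[OF \<psi>(1) ss_J fv] by (rule uf_Collect_cong[OF uf])
  qed
  moreover have "sat_list N (concat ya @ yb c1 s) \<phi> \<longleftrightarrow> s" for s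
  proof -
    have val: "sat_list M (map (\<lambda>j. x j F) (as @ bs c1 s)) \<phi> \<longleftrightarrow> s" if "ok {c1} F" for F
      using pat[of "card F"] pos_card[of F c1] that x_as[of F] x_bs[OF that, of s]
      unfolding k_pattern_def by (auto simp: ok_def bb_def)
    have "sat_list N (map y (as @ bs c1 s)) \<phi> \<longleftrightarrow>
      {F. sat_list M (map (\<lambda>j. x j F) (as @ bs c1 s)) \<phi>} \<in> \<U>"
      by (rule N_sat) (use \<phi> as_J bs_J[OF c1(1)] len_as in \<open>auto simp: bs_def\<close>)
    also have "\<dots> \<longleftrightarrow> {F. s} \<in> \<U>"
      by (rule uf_Collect_cong[OF uf], rule uf_up[OF uf c\<U>[OF c1(1)]]) (use val in blast)
    also have "\<dots> \<longleftrightarrow> s" using uf_UNIV[OF uf] uf_Compl[OF uf, of UNIV] by auto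
    finally show ?thesis by (simp add: ya_as yb_bs)
  qed
  moreover have "length (concat ya) = k * n" using len_as by (simp add: ya_as)
  ultimately have "k_splits L N ya B C" unfolding k_splits_def
    using \<phi> yb_B[OF c1(1)]
    by (intro exI[of _ \<phi>] exI[of _ "yb c1 True"] exI[of _ "yb c1 False"]) (auto simp: ya_def yb_def)
  then show False using C(3) by blast
qed

section \<open>Regularity of ineffable cardinals\<close>

locale ineffable_cardinal =
  fixes \<mu> :: "'c rel" and k :: nat
  assumes k_pos: "1 \<le> k" and ineff: "ineffable k \<mu>"
begin

abbreviation less (infix \<open>\<lhd>\<close> 50) where "\<alpha> \<lhd> \<beta> \<equiv> \<alpha> \<in> underS \<mu> \<beta>"

abbreviation inc :: "'c list \<Rightarrow> bool" where "inc \<equiv> sorted_wrt (\<lambda>\<alpha> \<beta>. \<alpha> \<lhd> \<beta>)"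

lemma Card: "Card_order \<mu>" and inf: "infinite (Field \<mu>)"
  using ineff by (auto simp: ineffable_def limit_cardinal_def)

lemma Cinf: "Cinfinite \<mu>"
  using Card inf by (simp add: cinfinite_def)

lemma wo: "wo_rel \<mu>"
  using Card by (simp add: wo_rel_def card_order_on_def)

lemma less_Field: "\<alpha> \<lhd> \<beta> \<Longrightarrow> \<alpha> \<in> Field \<mu>" "\<alpha> \<lhd> \<beta> \<Longrightarrow> \<beta> \<in> Field \<mu>"
  by (auto simp: underS_def Field_def)

lemma less_trans: "\<alpha> \<lhd> \<beta> \<Longrightarrow> \<beta> \<lhd> \<delta> \<Longrightarrow> \<alpha> \<lhd> \<delta>"
  using transD[OF wo_rel.TRANS[OF wo], of \<alpha> \<beta> \<delta>] antisymD[OF wo_rel.ANTISYM[OF wo], of \<alpha> \<beta>]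
  by (auto simp: underS_def)

lemma less_irrefl: "\<not> \<alpha> \<lhd> \<alpha>"
  by (simp add: underS_def)

lemma less_total: "\<alpha> \<in> Field \<mu> \<Longrightarrow> \<beta> \<in> Field \<mu> \<Longrightarrow> \<alpha> = \<beta> \<or> \<alpha> \<lhd> \<beta> \<or> \<beta> \<lhd> \<alpha>"
  using wo_rel.TOTALS[OF wo] by (auto simp: underS_def)

lemma less_asym: "\<alpha> \<lhd> \<beta> \<Longrightarrow> \<not> \<beta> \<lhd> \<alpha>"
  using less_trans less_irrefl by blast

lemma leq_less_trans: "(\<alpha>, \<beta>) \<in> \<mu> \<Longrightarrow> \<beta> \<lhd> \<delta> \<Longrightarrow> \<alpha> \<lhd> \<delta>"
  using less_trans[of \<alpha> \<beta> \<delta>] by (cases "\<alpha> = \<beta>") (auto simp: underS_def)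

lemma less_imp_leq: "\<alpha> \<lhd> \<beta> \<Longrightarrow> (\<alpha>, \<beta>) \<in> \<mu>"
  by (simp add: underS_def)

lemma leq_refl: "\<alpha> \<in> Field \<mu> \<Longrightarrow> (\<alpha>, \<alpha>) \<in> \<mu>"
  using wo_rel.REFL[OF wo] by (simp add: refl_on_def)

lemma ex_greater: "\<alpha> \<in> Field \<mu> \<Longrightarrow> \<exists>\<beta>\<in>Field \<mu>. \<alpha> \<lhd> \<beta>"
  using infinite_Card_order_limit[OF Card inf] by (auto simp: underS_def)

lemma finite_bounded:
  assumes "finite S" "S \<subseteq> Field \<mu>"
  shows "\<exists>\<beta>\<in>Field \<mu>. \<forall>s\<in>S. s \<lhd> \<beta>"
  using assms
proof (induction rule: finite_induct)
  case empty
  have "Field \<mu> \<noteq> {}" using inf by auto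
  then show ?case by auto
next
  case (insert x S)
  then obtain \<beta> where \<beta>: "\<beta> \<in> Field \<mu>" "\<forall>s\<in>S. s \<lhd> \<beta>" by auto
  obtain \<xi> where \<xi>: "\<xi> \<in> Field \<mu>" "x \<lhd> \<xi>" using ex_greater[of x] insert.prems by blast
  show ?case
  proof (cases "\<xi> \<lhd> \<beta>")
    case True
    then show ?thesis using \<beta> \<xi> less_trans by blast
  next
    case False
    then have "\<beta> = \<xi> \<or> \<beta> \<lhd> \<xi>" using less_total \<beta> \<xi> by blast
    then show ?thesis using \<beta> \<xi> less_trans by blast
  qed
qed

definition unbounded :: "'c set \<Rightarrow> bool" where
  "unbounded X \<longleftrightarrow> X \<subseteq> Field \<mu> \<and> (\<forall>\<delta>\<in>Field \<mu>. \<exists>x\<in>X. \<delta> \<lhd> x)"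

lemma ex_inc_above:
  assumes "unbounded X" "\<delta> \<in> Field \<mu>"
  shows "\<exists>l. inc l \<and> set l \<subseteq> X \<and> length l = n \<and> (\<forall>x\<in>set l. \<delta> \<lhd> x)"
  using assms(2)
proof (induction n arbitrary: \<delta>)
  case (Suc n)
  then obtain x where x: "x \<in> X" "\<delta> \<lhd> x" using assms unfolding unbounded_def by blast
  then obtain l where l: "inc l" "set l \<subseteq> X" "length l = n" "\<forall>y\<in>set l. x \<lhd> y"
    using Suc.IH[of x] less_Field by blast
  have "inc (x # l)" "set (x # l) \<subseteq> X" "length (x # l) = Suc n" "\<forall>y\<in>set (x # l). \<delta> \<lhd> y"
    using x l less_trans by auto
  then show ?case by blast
qed simp

lemma inc_hd:
  assumes "inc l" "l \<noteq> []" "x \<in> set l"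
  shows "x = hd l \<or> hd l \<lhd> x"
  using assms by (cases l) auto

lemma inc_distinct: "inc l \<Longrightarrow> distinct l"
  by (induction l) (auto simp: less_irrefl)

text \<open>Ineffability is about functions on sets, while types belong to ordered tuples.
  Uniqueness of the increasing enumeration mediates between the two.\<close>

lemma inc_eqI: "inc l \<Longrightarrow> inc l' \<Longrightarrow> set l = set l' \<Longrightarrow> l = l'"
proof (induction l arbitrary: l')
  case (Cons x l)
  then obtain y m where l': "l' = y # m" by (cases l') auto
  have "x = y" using Cons.prems less_asym unfolding l' by (metis insertE list.set(2) list.set_intros(1) sorted_wrt.simps(2))
  moreover have "set l = set m" using Cons.prems inc_distinct[of "x # l"] inc_distinct[of l']
    unfolding l' \<open>x = y\<close> by (simp add: insert_ident)
  ultimately show ?case using Cons l' by simp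
qed simp

lemma minim_set_Un:
  assumes l: "inc l" "l \<noteq> []" "set l \<subseteq> Field \<mu>" and l': "inc l'" "l' \<noteq> []" "set l' \<subseteq> Field \<mu>"
    and hd: "(hd l, hd l') \<in> \<mu>"
  shows "wo_rel.minim \<mu> (set l \<union> set l') = hd l"
proof (rule wo_rel.equals_minim[OF wo, symmetric])
  show "hd l \<in> set l \<union> set l'" using l by simp
  fix x assume "x \<in> set l \<union> set l'"
  then show "(hd l, x) \<in> \<mu>"
  proof
    assume "x \<in> set l"
    then have "x \<in> Field \<mu>" using l by blast
    then show ?thesis using inc_hd[OF l(1,2) \<open>x \<in> set l\<close>] leq_refl less_imp_leq by auto
  next
    assume x: "x \<in> set l'"
    have "x = hd l' \<or> (hd l', x) \<in> \<mu>" using inc_hd[OF l'(1,2) x] less_imp_leq by auto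
    then show ?thesis using hd transD[OF wo_rel.TRANS[OF wo]] by blast
  qed
qed (use l l' in auto)

lemma minim_set: "inc l \<Longrightarrow> l \<noteq> [] \<Longrightarrow> set l \<subseteq> Field \<mu> \<Longrightarrow> wo_rel.minim \<mu> (set l) = hd l"
  using minim_set_Un[of l l] leq_refl[of "hd l"] by (auto simp: subset_iff)

lemma inc_nsets: "inc l \<Longrightarrow> set l \<subseteq> X \<Longrightarrow> length l = n \<Longrightarrow> set l \<in> [X]\<^bsup>n\<^esup>"
  by (simp add: nsets_def distinct_card[OF inc_distinct])

text \<open>Closure is automatic: a point below a limit of \<open>C\<close> is below some member of
  \<open>C\<close> under that limit, and this member already bounds its value under
  \<open>F\<close>.\<close>

lemma club_if_cofinal:
  fixes F :: "'c \<Rightarrow> 'c" and \<delta> :: 'c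
  defines "C \<equiv> {\<alpha> \<in> Field \<mu>. \<delta> \<lhd> \<alpha> \<and> (\<forall>\<beta>. \<beta> \<lhd> \<alpha> \<longrightarrow> F \<beta> \<lhd> \<alpha>)}"
  assumes "\<And>\<alpha>. \<alpha> \<in> Field \<mu> \<Longrightarrow> \<exists>\<beta>\<in>C. \<alpha> \<lhd> \<beta>"
  shows "club \<mu> C"
  unfolding club_def
proof (intro conjI ballI impI)
  show "C \<subseteq> Field \<mu>" by (auto simp: C_def)
  show "cofinal C \<mu>" using assms(2) by (force simp: cofinal_def underS_def)
  fix \<xi> assume \<xi>: "\<xi> \<in> Field \<mu>"
    and lim: "underS \<mu> \<xi> \<noteq> {} \<and> (\<forall>\<beta>\<in>underS \<mu> \<xi>. \<exists>\<gamma>\<in>C \<inter> underS \<mu> \<xi>. \<beta> \<in> underS \<mu> \<gamma>)"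
  then obtain \<gamma> where "\<gamma> \<in> C" "\<gamma> \<lhd> \<xi>" by blast
  then have "\<delta> \<lhd> \<xi>" using less_trans unfolding C_def by blast
  moreover have "F \<beta> \<lhd> \<xi>" if "\<beta> \<lhd> \<xi>" for \<beta>
  proof -
    have "\<exists>\<gamma>\<in>C \<inter> underS \<mu> \<xi>. \<beta> \<lhd> \<gamma>" by (rule bspec[OF conjunct2[OF lim] that])
    then obtain \<gamma> where "\<gamma> \<in> C" "\<gamma> \<lhd> \<xi>" "\<beta> \<lhd> \<gamma>" by auto
    then have "F \<beta> \<lhd> \<gamma>" by (simp add: C_def)
    then show ?thesis using \<open>\<gamma> \<lhd> \<xi>\<close> by (rule less_trans)
  qed
  ultimately show "\<xi> \<in> C" using \<xi> by (simp add: C_def)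
qed

lemma stationary_unbounded:
  assumes "stationary \<mu> X"
  shows "unbounded X"
  unfolding unbounded_def
proof (intro conjI ballI)
  show "X \<subseteq> Field \<mu>" using assms by (simp add: stationary_def)
  fix \<delta> assume \<delta>: "\<delta> \<in> Field \<mu>"
  \<comment> \<open>With the identity for \<open>F\<close> this is the final segment above \<delta>.
    Its cofinality needs only finite bounds, so deriving regularity from it is not circular.\<close>
  have "club \<mu> {\<alpha> \<in> Field \<mu>. \<delta> \<lhd> \<alpha> \<and> (\<forall>\<beta>. \<beta> \<lhd> \<alpha> \<longrightarrow> \<beta> \<lhd> \<alpha>)}"
  proof (rule club_if_cofinal)
    fix \<alpha> assume "\<alpha> \<in> Field \<mu>"
    then obtain \<beta> where "\<beta> \<in> Field \<mu>" "\<forall>s\<in>{\<alpha>, \<delta>}. s \<lhd> \<beta>"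
      using finite_bounded[of "{\<alpha>, \<delta>}"] \<delta> by auto
    then show "\<exists>\<beta>\<in>{\<alpha> \<in> Field \<mu>. \<delta> \<lhd> \<alpha> \<and> (\<forall>\<beta>. \<beta> \<lhd> \<alpha> \<longrightarrow> \<beta> \<lhd> \<alpha>)}. \<alpha> \<lhd> \<beta>" by auto
  qed
  then show "\<exists>x\<in>X. \<delta> \<lhd> x" using assms unfolding stationary_def by blast
qed

text \<open>
  Regularity: if \<open>S\<close> is cofinal and \<open>|S| < \<mu>\<close>, code by an ordinal below a fixed \<open>\<nu> < \<mu>\<close> an element of
  \<open>S\<close> that is not below \<open>min A\<close>. On a homogeneous set this element is constant, so the set is bounded.
\<close>

lemma small_bounded:
  assumes S: "S \<subseteq> Field \<mu>" "|S| <o \<mu>"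
  shows "\<exists>\<beta>\<in>Field \<mu>. \<forall>s\<in>S. s \<lhd> \<beta>"
proof (rule ccontr)
  assume "\<not> ?thesis"
  then have "\<forall>\<beta>. \<exists>s. \<beta> \<in> Field \<mu> \<longrightarrow> s \<in> S \<and> \<not> s \<lhd> \<beta>" by blast
  then obtain g where g: "\<And>\<beta>. \<beta> \<in> Field \<mu> \<Longrightarrow> g \<beta> \<in> S \<and> \<not> g \<beta> \<lhd> \<beta>" by metis
  have Wo: "Well_order \<mu>" using Card by (simp add: card_order_on_def)
  obtain \<nu> where \<nu>: "\<nu> \<in> Field \<mu>" "|S| =o Restr \<mu> (underS \<mu> \<nu>)"
    using S(2) ordLess_iff_ordIso_Restr[OF Wo card_of_Well_order] by blast
  have "Field (Restr \<mu> (underS \<mu> \<nu>)) = underS \<mu> \<nu>"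
    using Field_Restr_ofilter[OF Wo] wo_rel.underS_ofilter[OF wo] by blast
  then have "|S| =o |underS \<mu> \<nu>|" using card_of_cong[OF \<nu>(2)] by (simp add: Field_card_of)
  then obtain h where h: "bij_betw h S (underS \<mu> \<nu>)" using card_of_ordIso by blast
  define f where "f A = (if \<nu> \<lhd> wo_rel.minim \<mu> A then {h (g (wo_rel.minim \<mu> A))} else {})" for A
  have "regressive \<mu> k f" unfolding regressive_def
  proof
    fix A assume A: "A \<in> [Field \<mu>]\<^bsup>k\<^esup>"
    let ?m = "wo_rel.minim \<mu> A"
    have "A \<noteq> {}" "A \<subseteq> Field \<mu>" using A k_pos by (auto simp: nsets_def)
    then have "?m \<in> Field \<mu>" by (intro wo_rel.minim_inField[OF wo])
    then have "h (g ?m) \<lhd> \<nu>" using g h by (auto simp: bij_betw_def)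
    then have "h (g ?m) \<lhd> ?m" if "\<nu> \<lhd> ?m" using that by (rule less_trans)
    then show "f A \<subseteq> underS \<mu> ?m" by (simp add: f_def)
  qed
  then obtain X where X: "stationary \<mu> X" "homogeneous \<mu> k f X"
    using ineff unfolding ineffable_def by blast
  have unb: "unbounded X" using X(1) by (rule stationary_unbounded)
  then have XF: "X \<subseteq> Field \<mu>" by (simp add: unbounded_def)
  have start: "\<exists>l. inc (x # l) \<and> set (x # l) \<in> [X]\<^bsup>k\<^esup>" if x: "x \<in> X" for x
  proof -
    obtain l where l: "inc l" "set l \<subseteq> X" "length l = k - 1" "\<forall>y\<in>set l. x \<lhd> y"
      using ex_inc_above[OF unb, of x "k - 1"] XF x by blast
    then have "inc (x # l)" by simp
    moreover have "set (x # l) \<in> [X]\<^bsup>k\<^esup>" using l x k_pos by (intro inc_nsets) auto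
    ultimately show ?thesis by blast
  qed
  obtain x0 where x0: "x0 \<in> X" "\<nu> \<lhd> x0" using unb \<nu>(1) by (auto simp: unbounded_def)
  have "g x0 \<in> Field \<mu>" using g[of x0] S x0 XF by auto
  \<comment> \<open>\<open>x1\<close> is taken above \<open>g x0\<close>: once
    \<open>g x1 = g x0\<close> is known, \<open>g x1\<close> is below \<open>x1\<close>, against the
    choice of \<open>g\<close>.\<close>
  then obtain \<beta> where \<beta>: "\<beta> \<in> Field \<mu>" "x0 \<lhd> \<beta>" "g x0 \<lhd> \<beta>"
    using finite_bounded[of "{x0, g x0}"] x0 XF by auto
  then obtain x1 where x1: "x1 \<in> X" "\<beta> \<lhd> x1" using unb by (auto simp: unbounded_def)
  have x01: "x0 \<lhd> x1" "g x0 \<lhd> x1" "\<nu> \<lhd> x1" using \<beta> x1 x0 less_trans by blast+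
  obtain l0 l1 where l0: "inc (x0 # l0)" "set (x0 # l0) \<in> [X]\<^bsup>k\<^esup>"
    and l1: "inc (x1 # l1)" "set (x1 # l1) \<in> [X]\<^bsup>k\<^esup>" using start x0 x1 by meson
  have F: "set (x0 # l0) \<subseteq> Field \<mu>" "set (x1 # l1) \<subseteq> Field \<mu>" using l0 l1 XF by (auto simp: nsets_def)
  have "f (set (x0 # l0)) \<inter> underS \<mu> x0 = f (set (x1 # l1)) \<inter> underS \<mu> x0"
    using X(2) l0(2) l1(2) minim_set_Un[OF l0(1) _ F(1) l1(1) _ F(2)] less_imp_leq[OF x01(1)]
    unfolding homogeneous_def by (metis list.sel(1) list.distinct(1))
  moreover have "f (set (x0 # l0)) = {h (g x0)}" "f (set (x1 # l1)) = {h (g x1)}"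
    using x0 x01 minim_set[OF l0(1) _ F(1)] minim_set[OF l1(1) _ F(2)] by (simp_all add: f_def)
  moreover have gS: "g x0 \<in> S" "g x1 \<in> S" using g x0 x1 XF by auto
  then have "h (g x0) \<lhd> \<nu>" "h (g x1) \<lhd> \<nu>" using h by (auto simp: bij_betw_def)
  then have "h (g x0) \<lhd> x0" "h (g x1) \<lhd> x0" using x0(2) less_trans by blast+
  ultimately have "h (g x0) = h (g x1)" by auto
  then have "g x0 = g x1" using h gS by (auto simp: bij_betw_def inj_on_def)
  then show False using g[of x1] x01 x1 XF by auto
qed

lemma unbounded_card:
  assumes "unbounded X"
  shows "|X| =o \<mu>"
proof -
  have X: "X \<subseteq> Field \<mu>" using assms by (simp add: unbounded_def)
  have "|X| \<le>o \<mu>" using card_of_mono1[OF X] card_of_Field_ordIso[OF Card] ordLeq_ordIso_trans by blast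
  moreover have "\<not> |X| <o \<mu>"
  proof
    assume "|X| <o \<mu>"
    then obtain \<beta> where "\<beta> \<in> Field \<mu>" "\<forall>x\<in>X. x \<lhd> \<beta>" using small_bounded X by blast
    then show False using assms less_asym unfolding unbounded_def by blast
  qed
  ultimately show ?thesis by (simp add: ordLeq_iff_ordLess_or_ordIso)
qed

lemma small_bounded_image:
  assumes "|A| <o \<mu>" "\<And>x. x \<in> A \<Longrightarrow> f x \<in> Field \<mu>"
  shows "\<exists>\<beta>\<in>Field \<mu>. \<forall>x\<in>A. f x \<lhd> \<beta>"
  using small_bounded[of "f ` A"] ordLeq_ordLess_trans[OF card_of_image assms(1)] assms(2) by blast

end

text \<open>With regularity, uncountability keeps suprema of countable sequences below \<mu>. In the
  theorem it follows from there being infinitely many formulas.\<close>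

locale uncountable_ineffable_cardinal = ineffable_cardinal +
  assumes uncountable: "natLeq <o \<mu>"
begin

lemma small_nat: "|UNIV :: nat set| <o \<mu>"
  using uncountable card_of_nat ordIso_ordLess_trans by blast

text \<open>By regularity some \<open>G \<alpha>\<close> bounds the values of \<open>F\<close> below
  \<alpha>. The supremum of countably many iterates of \<open>G\<close> is then a closure point of
  \<open>F\<close>.\<close>

lemma club_closure_points:
  assumes \<delta>: "\<delta> \<in> Field \<mu>" and F: "\<And>\<beta>. \<beta> \<in> Field \<mu> \<Longrightarrow> F \<beta> \<in> Field \<mu>"
  shows "club \<mu> {\<alpha> \<in> Field \<mu>. \<delta> \<lhd> \<alpha> \<and> (\<forall>\<beta>. \<beta> \<lhd> \<alpha> \<longrightarrow> F \<beta> \<lhd> \<alpha>)}"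
proof (rule club_if_cofinal)
  have "\<exists>\<beta>\<in>Field \<mu>. \<alpha> \<lhd> \<beta> \<and> (\<forall>\<xi>. \<xi> \<lhd> \<alpha> \<longrightarrow> F \<xi> \<lhd> \<beta>)" if \<alpha>: "\<alpha> \<in> Field \<mu>" for \<alpha>
  proof -
    obtain \<beta> where \<beta>: "\<beta> \<in> Field \<mu>" "\<forall>\<xi>\<in>underS \<mu> \<alpha>. F \<xi> \<lhd> \<beta>"
      using small_bounded_image[of "underS \<mu> \<alpha>" F] card_of_underS[OF Card \<alpha>] F less_Field by blast
    obtain \<beta>' where "\<beta>' \<in> Field \<mu>" "\<alpha> \<lhd> \<beta>'" "\<beta> \<lhd> \<beta>'"
      using finite_bounded[of "{\<alpha>, \<beta>}"] \<alpha> \<beta> by auto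
    then show ?thesis using \<beta> less_trans by blast
  qed
  then obtain G where G: "\<And>\<alpha>. \<alpha> \<in> Field \<mu> \<Longrightarrow> G \<alpha> \<in> Field \<mu> \<and> \<alpha> \<lhd> G \<alpha> \<and> (\<forall>\<xi>. \<xi> \<lhd> \<alpha> \<longrightarrow> F \<xi> \<lhd> G \<alpha>)"
    by metis
  fix \<alpha> assume \<alpha>: "\<alpha> \<in> Field \<mu>"
  then obtain \<beta>0 where \<beta>0: "\<beta>0 \<in> Field \<mu>" "\<alpha> \<lhd> \<beta>0" "\<delta> \<lhd> \<beta>0"
    using finite_bounded[of "{\<alpha>, \<delta>}"] \<delta> by auto
  define s where "s n = (G ^^ n) \<beta>0" for n
  have s: "s n \<in> Field \<mu>" for n by (induction n) (use \<beta>0 G in \<open>auto simp: s_def\<close>)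
  have sS: "s n \<lhd> s (Suc n)" "\<xi> \<lhd> s n \<Longrightarrow> F \<xi> \<lhd> s (Suc n)" for n \<xi>
    using G[OF s[of n]] by (auto simp: s_def)
  \<comment> \<open>The sequence \<open>s\<close> increases strictly, so its least strict upper
    bound is its supremum.\<close>
  let ?U = "{\<beta> \<in> Field \<mu>. \<forall>n. s n \<lhd> \<beta>}"
  have "?U \<noteq> {}" using small_bounded_image[OF small_nat, of s] s by blast
  then have \<epsilon>: "wo_rel.minim \<mu> ?U \<in> ?U" by (intro wo_rel.minim_in[OF wo]) auto
  let ?\<epsilon> = "wo_rel.minim \<mu> ?U"
  have "F \<xi> \<lhd> ?\<epsilon>" if \<xi>: "\<xi> \<lhd> ?\<epsilon>" for \<xi>
  proof -
    have "\<xi> \<notin> ?U"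
    proof
      assume "\<xi> \<in> ?U"
      then have "(?\<epsilon>, \<xi>) \<in> \<mu>" by (intro wo_rel.minim_least[OF wo]) auto
      then show False using leq_less_trans \<xi> less_irrefl by blast
    qed
    then obtain n where "\<not> s n \<lhd> \<xi>" using less_Field(1)[OF \<xi>] by blast
    then have "\<xi> = s n \<or> \<xi> \<lhd> s n" using less_total s less_Field(1)[OF \<xi>] by blast
    then have "\<xi> \<lhd> s (Suc n)" using sS less_trans by blast
    then have "F \<xi> \<lhd> s (Suc (Suc n))" by (rule sS)
    then show ?thesis using \<epsilon> less_trans by blast
  qed
  moreover have "\<beta>0 \<lhd> ?\<epsilon>" using \<epsilon> by (auto simp: s_def dest: spec[of _ 0])
  then have "\<alpha> \<lhd> ?\<epsilon>" "\<delta> \<lhd> ?\<epsilon>" using \<beta>0 less_trans by blast+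
  ultimately show "\<exists>\<beta>\<in>{\<alpha> \<in> Field \<mu>. \<delta> \<lhd> \<alpha> \<and> (\<forall>\<beta>. \<beta> \<lhd> \<alpha> \<longrightarrow> F \<beta> \<lhd> \<alpha>)}. \<alpha> \<lhd> \<beta>"
    using \<epsilon> by blast
qed

section \<open>Sets of size less than \<mu>\<close>

lemma small_lists:
  assumes "|A| <o \<mu>"
  shows "|lists A| <o \<mu>"
proof -
  \<comment> \<open>The summand \<open>nat\<close> makes the bound infinite even when
    \<open>A\<close> is finite.\<close>
  let ?r = "|A <+> (UNIV :: nat set)|"
  have r: "Cinfinite ?r" by (simp add: cinfinite_def Field_card_of card_of_card_order_on)
  have "|lists A| \<le>o ?r" by (rule card_of_lists_ordLeq[OF card_of_Plus1 r])
  moreover have "?r <o \<mu>"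
    by (rule card_of_Plus_ordLess_infinite_Field) (use inf Card assms small_nat in auto)
  ultimately show ?thesis by (rule ordLeq_ordLess_trans)
qed

lemma small_Plus: "|A| <o \<mu> \<Longrightarrow> |B| <o \<mu> \<Longrightarrow> |A <+> B| <o \<mu>"
  by (rule card_of_Plus_ordLess_infinite_Field) (use inf Card in auto)

lemma small_Times:
  assumes "|A| <o \<mu>" "|B| <o \<mu>"
  shows "|A \<times> B| <o \<mu>"
proof -
  have "|A \<times> B| \<le>o |lists (A <+> B)|"
    by (rule card_of_ordLeqI[of "\<lambda>(x, y). [Inl x, Inr y]"]) (auto simp: inj_on_def)
  then show ?thesis using small_lists[OF small_Plus[OF assms]] by (rule ordLeq_ordLess_trans)
qed

lemma small_subset: "A \<subseteq> B \<Longrightarrow> |B| <o \<mu> \<Longrightarrow> |A| <o \<mu>"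
  using card_of_mono1 ordLeq_ordLess_trans by blast

lemma small_Un: "|A| <o \<mu> \<Longrightarrow> |B| <o \<mu> \<Longrightarrow> |A \<union> B| <o \<mu>"
  using Un_Cinfinite_bound_strict[OF _ _ Cinf] by blast

lemma small_image: "|A| <o \<mu> \<Longrightarrow> |f ` A| <o \<mu>"
  using card_of_image ordLeq_ordLess_trans by blast

lemma small_under: "\<alpha> \<in> Field \<mu> \<Longrightarrow> |under \<mu> \<alpha>| <o \<mu>"
proof -
  assume \<alpha>: "\<alpha> \<in> Field \<mu>"
  obtain \<beta> where "\<beta> \<in> Field \<mu>" "\<alpha> \<lhd> \<beta>" using ex_greater[OF \<alpha>] by blast
  moreover have "under \<mu> \<alpha> \<subseteq> underS \<mu> \<beta>" using leq_less_trans[OF _ \<open>\<alpha> \<lhd> \<beta>\<close>] unfolding under_def by blast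
  ultimately show ?thesis using card_of_underS[OF Card] small_subset by blast
qed

end

section \<open>Coherent types\<close>

locale sequence_in_model = uncountable_ineffable_cardinal \<mu> k
  for \<mu> :: "'c rel" and k :: nat +
  fixes L :: "('f, 'r) language" and M :: "('f, 'r, 'm) struct" and B :: "'m set"
    and G :: "'g set" and a :: "'c \<Rightarrow> 'g \<Rightarrow> 'm"
  assumes small_formulas: "|formulas L| <o \<mu>" and small_B: "|B| <o \<mu>" and small_G: "|G| <o \<mu>"
begin

definition params :: "'c set \<Rightarrow> 'm set" where
  "params I = B \<union> (\<lambda>(i, g). a i g) ` (I \<times> G)"

text \<open>
  In the type of the tuples with indices in the list \<open>A\<close>, the code \<open>Inl (p, g)\<close> is a variable, standing for
  coordinate \<open>g\<close> of entry \<open>p\<close>, and \<open>Inr m\<close> is a parameter.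
\<close>

fun val :: "'c list \<Rightarrow> nat \<times> 'g + 'm \<Rightarrow> 'm" where
  "val A (Inl (p, g)) = a (A ! p) g"
| "val A (Inr m) = m"

text \<open>\<open>R\<close> is the set of admissible positions. Coherence treats the values of
  codes as given and allows all positions; the induction on length restricts them, so that appending
  to a list does not change the values.\<close>

definition codes :: "nat set \<Rightarrow> 'm set \<Rightarrow> (nat \<times> 'g + 'm) set" where
  "codes R D = (R \<times> G) <+> D"

lemma params_mono: "I \<subseteq> J \<Longrightarrow> params I \<subseteq> params J"
  by (auto simp: params_def)

lemma codes_mono: "R \<subseteq> R' \<Longrightarrow> D \<subseteq> D' \<Longrightarrow> codes R D \<subseteq> codes R' D'"
  by (auto simp: codes_def)

lemma underS_mono: "(\<alpha>, \<beta>) \<in> \<mu> \<Longrightarrow> underS \<mu> \<alpha> \<subseteq> underS \<mu> \<beta>"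
  using underS_incr[OF wo_rel.TRANS[OF wo] wo_rel.ANTISYM[OF wo]] .

text \<open>Closure of \<alpha> under a function only speaks of single \<beta> below \<alpha>, so
  the finitely many parameters have to be captured by one such \<beta>. If there are none,
  \<open>\<beta>0\<close> serves.\<close>

lemma finite_codes_bounded:
  assumes "\<beta>0 \<lhd> \<alpha>" "set q \<subseteq> codes UNIV (params (underS \<mu> \<alpha>))"
  shows "\<exists>\<beta>. \<beta> \<lhd> \<alpha> \<and> set q \<subseteq> codes UNIV (params (under \<mu> \<beta>))"
  using assms(2)
proof (induction q)
  case Nil
  then show ?case using assms(1) by auto
next
  case (Cons x q)
  then obtain \<beta> where \<beta>: "\<beta> \<lhd> \<alpha>" "set q \<subseteq> codes UNIV (params (under \<mu> \<beta>))" by auto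
  have "\<exists>\<beta>'. \<beta>' \<lhd> \<alpha> \<and> x \<in> codes UNIV (params (under \<mu> \<beta>'))"
  proof -
    have "x \<in> codes UNIV (params (underS \<mu> \<alpha>))" using Cons.prems by simp
    then consider "x \<in> codes UNIV B" | i g where "x = Inr (a i g)" "i \<lhd> \<alpha>" "g \<in> G"
      by (auto simp: codes_def params_def)
    then show ?thesis
    proof cases
      case 1
      then show ?thesis using \<beta>(1) by (auto simp: codes_def params_def)
    next
      case (2 i g)
      moreover have "i \<in> under \<mu> i" using leq_refl less_Field(1)[OF 2(2)] by (simp add: under_def)
      ultimately show ?thesis by (intro exI[of _ i]) (auto simp: codes_def params_def)
    qed
  qed
  then obtain \<beta>' where \<beta>': "\<beta>' \<lhd> \<alpha>" "x \<in> codes UNIV (params (under \<mu> \<beta>'))" by blast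
  have under: "under \<mu> \<xi> \<subseteq> under \<mu> \<zeta>" if "\<xi> = \<zeta> \<or> \<xi> \<lhd> \<zeta>" for \<xi> \<zeta>
    using that transD[OF wo_rel.TRANS[OF wo], of _ \<xi> \<zeta>] by (auto simp: under_def underS_def)
  have "codes UNIV (params (under \<mu> \<xi>)) \<subseteq> codes UNIV (params (under \<mu> \<zeta>))"
    if "\<xi> = \<zeta> \<or> \<xi> \<lhd> \<zeta>" for \<xi> \<zeta> by (intro codes_mono params_mono under that order_refl)
  moreover have "\<beta> = \<beta>' \<or> \<beta> \<lhd> \<beta>' \<or> \<beta>' \<lhd> \<beta>" using less_total \<beta> \<beta>' less_Field by blast
  ultimately have "\<exists>\<zeta>\<in>{\<beta>, \<beta>'}. set (x # q) \<subseteq> codes UNIV (params (under \<mu> \<zeta>))"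
    using \<beta>(2) \<beta>'(2) by (simp add: subset_iff) blast
  then show ?case using \<beta> \<beta>' by blast
qed

text \<open>
  The regressive function sends \<open>A\<close> to the type of the tuples with indices in \<open>A\<close> over the parameters below
  \<open>min A\<close>, its formulas being numbered by ordinals below \<open>\<mu>\<close>. On a club of ordinals \<open>\<alpha>\<close>, formulas with parameters
  below \<open>\<alpha>\<close> have numbers below \<open>\<alpha>\<close>.
\<close>

lemma ex_coherent_set:
  "\<exists>X. unbounded X \<and> (\<forall>A A' \<phi> q. inc A \<and> inc A' \<and> set A \<subseteq> X \<and> set A' \<subseteq> X \<and>
    length A = k \<and> length A' = k \<and> (hd A, hd A') \<in> \<mu> \<and> \<phi> \<in> formulas L \<and>
    set q \<subseteq> codes UNIV (params (underS \<mu> (hd A))) \<longrightarrow>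
    (sat_list M (map (val A) q) \<phi> \<longleftrightarrow> sat_list M (map (val A') q) \<phi>))"
proof -
  define P where "P I = formulas L \<times> lists (codes UNIV (params I))" for I
  have small_P: "|P I| <o \<mu>" if "|I| <o \<mu>" for I
    unfolding P_def codes_def params_def
    by (intro small_Times small_lists small_Plus small_Un small_image small_nat small_formulas
        small_B small_G that)
  have "|P (Field \<mu>)| \<le>o \<mu>"
  proof -
    have "|Field \<mu> \<times> G| \<le>o \<mu>"
      using card_of_Times_ordLeq_infinite_Field[OF inf _ ordLess_imp_ordLeq[OF small_G] Card]
        ordIso_imp_ordLeq[OF card_of_Field_ordIso[OF Card]] by blast
    then have "|params (Field \<mu>)| \<le>o \<mu>" unfolding params_def
      by (intro Un_Cinfinite_bound Cinf ordLess_imp_ordLeq[OF small_B] ordLeq_transitive[OF card_of_image])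
    then have "|codes UNIV (params (Field \<mu>))| \<le>o \<mu>" unfolding codes_def
      by (intro card_of_Plus_ordLeq_infinite_Field[OF inf _ _ Card]
          ordLess_imp_ordLeq[OF small_Times[OF small_nat small_G]])
    then show ?thesis unfolding P_def
      by (intro card_of_Times_ordLeq_infinite_Field[OF inf _ _ Card]
          ordLess_imp_ordLeq[OF small_formulas] card_of_lists_ordLeq Cinf)
  qed
  also have "\<mu> =o |Field \<mu>|" using Card card_of_Field_ordIso ordIso_symmetric by blast
  finally obtain c where c: "inj_on c (P (Field \<mu>))" "c ` P (Field \<mu>) \<subseteq> Field \<mu>"
    using card_of_ordLeq[of "P (Field \<mu>)" "Field \<mu>"] by auto
  have P_mono: "P I \<subseteq> P J" if "I \<subseteq> J" for I J
    using codes_mono[OF order_refl params_mono[OF that]] by (auto simp: P_def)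
  \<comment> \<open>Fewer than \<mu> formulas have parameters with indices up to \<beta>, so
    regularity bounds their numbers; \<open>F\<close> will choose a bound.\<close>
  have "\<exists>\<xi>\<in>Field \<mu>. \<forall>p\<in>P (under \<mu> \<beta>). c p \<lhd> \<xi>" if \<beta>: "\<beta> \<in> Field \<mu>" for \<beta>
    using small_bounded_image[OF small_P[OF small_under[OF \<beta>]], of c] c(2)
      P_mono[OF under_Field[of \<mu> \<beta>]] by blast
  then obtain F where F: "\<And>\<beta>. \<beta> \<in> Field \<mu> \<Longrightarrow> F \<beta> \<in> Field \<mu>"
    "\<And>\<beta> p. \<beta> \<in> Field \<mu> \<Longrightarrow> p \<in> P (under \<mu> \<beta>) \<Longrightarrow> c p \<lhd> F \<beta>" by metis
  define f where "f S = {c (\<phi>, q) | \<phi> q l. inc l \<and> set l = S \<and> (\<phi>, q) \<in> P (Field \<mu>) \<and>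
    sat_list M (map (val l) q) \<phi>} \<inter> underS \<mu> (wo_rel.minim \<mu> S)" for S
  have f_iff: "c (\<phi>, q) \<in> f (set A) \<longleftrightarrow> sat_list M (map (val A) q) \<phi>"
    if "inc A" "(\<phi>, q) \<in> P (Field \<mu>)" "c (\<phi>, q) \<lhd> wo_rel.minim \<mu> (set A)" for A \<phi> q
  proof
    assume "c (\<phi>, q) \<in> f (set A)"
    then obtain \<phi>' q' l where l: "c (\<phi>, q) = c (\<phi>', q')" "inc l" "set l = set A"
      "(\<phi>', q') \<in> P (Field \<mu>)" "sat_list M (map (val l) q') \<phi>'" unfolding f_def by blast
    then have "(\<phi>, q) = (\<phi>', q')" using c(1) that(2) by (meson inj_onD)
    moreover have "l = A" using l that inc_eqI by blast
    ultimately show "sat_list M (map (val A) q) \<phi>" using l by simp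
  qed (use that in \<open>auto simp: f_def\<close>)
  have "regressive \<mu> k f" unfolding regressive_def f_def by blast
  then obtain X0 where X0: "stationary \<mu> X0" "homogeneous \<mu> k f X0"
    using ineff unfolding ineffable_def by blast
  have X0F: "X0 \<subseteq> Field \<mu>" using X0 by (simp add: stationary_def)
  \<comment> \<open>Requiring \<open>underS \<mu> x \<noteq> {}\<close> excludes the least ordinal,
    so some \<beta> below \<open>x\<close> exists even for formulas without parameters.\<close>
  define X where "X = {x \<in> X0. underS \<mu> x \<noteq> {} \<and> (\<forall>\<beta>. \<beta> \<lhd> x \<longrightarrow> F \<beta> \<lhd> x)}"
  have "unbounded X" unfolding unbounded_def
  proof (intro conjI ballI)
    show "X \<subseteq> Field \<mu>" using X0F by (auto simp: X_def)
    fix \<delta> assume "\<delta> \<in> Field \<mu>"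
    then have "club \<mu> {\<alpha> \<in> Field \<mu>. \<delta> \<lhd> \<alpha> \<and> (\<forall>\<beta>. \<beta> \<lhd> \<alpha> \<longrightarrow> F \<beta> \<lhd> \<alpha>)}"
      using F(1) by (rule club_closure_points)
    then have "X0 \<inter> {\<alpha> \<in> Field \<mu>. \<delta> \<lhd> \<alpha> \<and> (\<forall>\<beta>. \<beta> \<lhd> \<alpha> \<longrightarrow> F \<beta> \<lhd> \<alpha>)} \<noteq> {}"
      using X0(1) unfolding stationary_def by blast
    then show "\<exists>x\<in>X. \<delta> \<lhd> x" unfolding X_def by blast
  qed
  moreover have "sat_list M (map (val A) q) \<phi> \<longleftrightarrow> sat_list M (map (val A') q) \<phi>"
    if A: "inc A" "set A \<subseteq> X" "length A = k" and A': "inc A'" "set A' \<subseteq> X" "length A' = k"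
      and hd: "(hd A, hd A') \<in> \<mu>" and \<phi>: "\<phi> \<in> formulas L"
      and q: "set q \<subseteq> codes UNIV (params (underS \<mu> (hd A)))" for A A' \<phi> q
  proof -
    have X: "X \<subseteq> X0" "X \<subseteq> Field \<mu>" using X0F by (auto simp: X_def)
    have ne: "A \<noteq> []" "A' \<noteq> []" using A(3) A'(3) k_pos by auto
    have AF: "set A \<subseteq> Field \<mu>" "set A' \<subseteq> Field \<mu>" using A A' X by auto
    have hdX: "hd A \<in> X" using A ne by auto
    then obtain \<beta>0 where "\<beta>0 \<lhd> hd A" unfolding X_def by blast
    then obtain \<beta> where \<beta>: "\<beta> \<lhd> hd A" "set q \<subseteq> codes UNIV (params (under \<mu> \<beta>))"
      using finite_codes_bounded q by blast
    then have p: "(\<phi>, q) \<in> P (under \<mu> \<beta>)" using \<phi> by (auto simp: P_def)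
    then have pF: "(\<phi>, q) \<in> P (Field \<mu>)" using P_mono[OF under_Field] by blast
    have "c (\<phi>, q) \<lhd> F \<beta>" using F(2)[OF less_Field(1)[OF \<beta>(1)] p] .
    moreover have "F \<beta> \<lhd> hd A" using hdX \<beta>(1) unfolding X_def by blast
    ultimately have c1: "c (\<phi>, q) \<lhd> hd A" by (rule less_trans)
    then have c2: "c (\<phi>, q) \<lhd> hd A'" using underS_mono[OF hd] by blast
    have "set A \<in> [X0]\<^bsup>k\<^esup>" "set A' \<in> [X0]\<^bsup>k\<^esup>" using A A' X by (auto intro!: inc_nsets)
    then have "f (set A) \<inter> underS \<mu> (hd A) = f (set A') \<inter> underS \<mu> (hd A)"
      using X0(2) minim_set_Un[OF A(1) ne(1) AF(1) A'(1) ne(2) AF(2) hd]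
      unfolding homogeneous_def by metis
    then have "c (\<phi>, q) \<in> f (set A) \<longleftrightarrow> c (\<phi>, q) \<in> f (set A')" using c1 by blast
    then show ?thesis
      using f_iff[OF A(1) pF] f_iff[OF A'(1) pF] minim_set[OF A(1) ne(1) AF(1)]
        minim_set[OF A'(1) ne(2) AF(2)] c1 c2 by simp
  qed
  ultimately show ?thesis by blast
qed

end

locale coherent_sequence = sequence_in_model \<mu> k L M B G a
  for \<mu> :: "'c rel" and k :: nat and L :: "('f, 'r) language" and M :: "('f, 'r, 'm) struct"
    and B :: "'m set" and G :: "'g set" and a :: "'c \<Rightarrow> 'g \<Rightarrow> 'm" +
  fixes X :: "'c set"
  assumes X: "unbounded X"
    and coherent_le: "\<And>A A' \<phi> q. inc A \<Longrightarrow> inc A' \<Longrightarrow> set A \<subseteq> X \<Longrightarrow> set A' \<subseteq> X \<Longrightarrow>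
      length A = k \<Longrightarrow> length A' = k \<Longrightarrow> (hd A, hd A') \<in> \<mu> \<Longrightarrow> \<phi> \<in> formulas L \<Longrightarrow>
      set q \<subseteq> codes UNIV (params (underS \<mu> (hd A))) \<Longrightarrow>
      sat_list M (map (val A) q) \<phi> \<longleftrightarrow> sat_list M (map (val A') q) \<phi>"
begin

section \<open>Increasing \<open>k\<close>-tuples from the coherent set\<close>

lemma X_Field: "X \<subseteq> Field \<mu>"
  using X by (simp add: unbounded_def)

definition ksub :: "'c list \<Rightarrow> bool" where
  "ksub A \<longleftrightarrow> inc A \<and> set A \<subseteq> X \<and> length A = k"

lemma ksub_hd:
  assumes "ksub A"
  shows "hd A \<in> set A" "hd A \<in> Field \<mu>"
proof -
  have "A \<noteq> []" using assms k_pos by (auto simp: ksub_def)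
  then show "hd A \<in> set A" by simp
  then show "hd A \<in> Field \<mu>" using assms X_Field by (auto simp: ksub_def)
qed

lemma coherent:
  assumes A: "ksub A" "ksub A'" and \<phi>: "\<phi> \<in> formulas L"
    and q: "set q \<subseteq> codes UNIV (params (underS \<mu> (hd A)))" "set q \<subseteq> codes UNIV (params (underS \<mu> (hd A')))"
  shows "sat_list M (map (val A) q) \<phi> \<longleftrightarrow> sat_list M (map (val A') q) \<phi>"
proof -
  have "(hd A, hd A') \<in> \<mu> \<or> (hd A', hd A) \<in> \<mu>"
    using wo_rel.TOTALS[OF wo] ksub_hd A by blast
  then show ?thesis
    using coherent_le[of A A' \<phi> q] coherent_le[of A' A \<phi> q] A \<phi> q unfolding ksub_def by blast
qed

lemma ex_ksub_above: "\<delta> \<in> Field \<mu> \<Longrightarrow> \<exists>A. ksub A \<and> (\<forall>x\<in>set A. \<delta> \<lhd> x)"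
  using ex_inc_above[OF X] unfolding ksub_def by blast

text \<open>\<open>sl\<close> selects finitely many coordinates from \<open>G\<close>, since
  splitting concerns finite tuples. The same selection at every index gives the \<open>k\<close>
  tuples equal length.\<close>

definition tuple :: "'g list \<Rightarrow> 'c list \<Rightarrow> 'm list list" where
  "tuple sl A = map (\<lambda>i. map (a i) sl) A"

lemma concat_tuple:
  assumes "length A = k"
  shows "concat (tuple sl A) = map (val A) (concat (map (\<lambda>p. map (\<lambda>g. Inl (p, g)) sl) [0..<k]))"
proof -
  have "tuple sl A = map (\<lambda>p. map (a (A ! p)) sl) [0..<k]"
    unfolding tuple_def using assms by (intro nth_equalityI) auto
  then show ?thesis by (simp add: map_concat comp_def)
qed

lemma length_concat_tuple: "length (concat (tuple sl A)) = length A * length sl"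
  by (simp add: tuple_def length_concat comp_def sum_list_triv)

text \<open>
  If splitting over \<open>params (underS \<mu> \<delta>)\<close> recurs for cofinally many \<open>\<delta>\<close>, it does so for one formula, by the
  regularity of \<open>\<mu>\<close>; coherence then replaces the many realizations by a single one.
\<close>

lemma eventually_nonsplitting:
  assumes no_pattern: "\<And>\<phi> n m. \<phi> \<in> formulas L \<Longrightarrow> fv \<phi> \<subseteq> {..<k * n + m} \<Longrightarrow>
      \<exists>N. \<forall>x b b'. \<not> k_pattern L M k n m \<phi> N x b b'"
    and Dom: "B \<subseteq> Dom M" "\<And>i g. i \<in> Field \<mu> \<Longrightarrow> g \<in> G \<Longrightarrow> a i g \<in> Dom M"
  shows "\<exists>\<delta>\<in>Field \<mu>. \<forall>A sl. ksub A \<longrightarrow> \<delta> \<lhd> hd A \<longrightarrow> set sl \<subseteq> G \<longrightarrow>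
    \<not> k_splits L M (tuple sl A) (params (underS \<mu> (hd A))) (params (underS \<mu> \<delta>))"
proof -
  define bad where "bad \<phi> sl m \<delta> A b b' \<longleftrightarrow> ksub A \<and> \<delta> \<lhd> hd A \<and>
    set b \<subseteq> params (underS \<mu> (hd A)) \<and> set b' \<subseteq> params (underS \<mu> (hd A)) \<and>
    length b = m \<and> length b' = m \<and>
    (\<forall>p<k. same_type_over L M (params (underS \<mu> \<delta>) \<union> (\<Union>j\<in>{..<k} - {p}. set (tuple sl A ! j))) b b') \<and>
    sat_list M (concat (tuple sl A) @ b) \<phi> \<and> \<not> sat_list M (concat (tuple sl A) @ b') \<phi>"
    for \<phi> sl m \<delta> A b b'
  \<comment> \<open>A key fixes what a pattern keeps constant: formula, coordinates and parameter
    length. Only finite lists of coordinates occur, hence there are fewer than \<mu> keys.\<close>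
  define keys where "keys = {(\<phi>, sl, m). \<phi> \<in> formulas L \<and> set sl \<subseteq> G \<and> fv \<phi> \<subseteq> {..<k * length sl + m}}"
  have "keys \<subseteq> formulas L \<times> lists G \<times> (UNIV :: nat set)" by (auto simp: keys_def)
  then have small_keys: "|keys| <o \<mu>"
    by (rule small_subset) (intro small_Times small_lists small_formulas small_G small_nat)
  have "\<exists>\<delta>\<in>Field \<mu>. \<forall>A b b'. \<not> bad \<phi> sl m \<delta> A b b'" if key: "(\<phi>, sl, m) \<in> keys" for \<phi> sl m
  proof (rule ccontr)
    assume "\<not> ?thesis"
    then obtain A b b' where bad: "\<And>\<delta>. \<delta> \<in> Field \<mu> \<Longrightarrow> bad \<phi> sl m \<delta> (A \<delta>) (b \<delta>) (b' \<delta>)" by metis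
    have \<phi>: "\<phi> \<in> formulas L" "fv \<phi> \<subseteq> {..<k * length sl + m}" and sl: "set sl \<subseteq> G"
      using key by (auto simp: keys_def)
    obtain N where N: "\<And>x b b'. \<not> k_pattern L M k (length sl) m \<phi> N x b b'"
      using no_pattern[OF \<phi>] by blast
    obtain \<delta>0 where \<delta>0: "\<delta>0 \<in> Field \<mu>" using inf by fastforce
    define s where "s n = ((\<lambda>\<delta>. hd (A \<delta>)) ^^ n) \<delta>0" for n
    have s_Suc: "s (Suc n) = hd (A (s n))" for n by (simp add: s_def)
    have s_Field: "s n \<in> Field \<mu>" for n
    proof (induction n)
      case (Suc n)
      then show ?case using bad[OF Suc] ksub_hd(2) unfolding s_Suc bad_def by blast
    qed (simp add: s_def \<delta>0)
    have bad_s: "bad \<phi> sl m (s n) (A (s n)) (b (s n)) (b' (s n))" for n using bad s_Field by blast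
    have s_less: "s n \<lhd> s (Suc n)" for n using bad_s[of n] unfolding bad_def s_Suc by blast
    have s_mono: "i < j \<Longrightarrow> s i \<lhd> s j" for i j
    proof (induction j)
      case (Suc j)
      then show ?case using s_less[of j] less_trans by (cases "i = j") auto
    qed simp
    have s_leq: "(s i, s j) \<in> \<mu>" if "i \<le> j" for i j
      using s_mono[of i j] s_Field[of i] that leq_refl less_imp_leq by (cases "i = j") auto
    \<comment> \<open>Being above all \<open>N\<close> stages, \<open>A1\<close> agrees with each
      \<open>A (s i)\<close>, for \<open>i < N\<close>, on formulas with parameters below
      \<open>s (Suc i)\<close>.\<close>
    obtain A1 where A1: "ksub A1" "\<forall>x\<in>set A1. s N \<lhd> x" using ex_ksub_above[OF s_Field] by blast
    have hdA1: "s N \<lhd> hd A1" using A1 ksub_hd by blast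
    have b_params: "set (b (s i)) \<subseteq> params (underS \<mu> (s (Suc i)))"
      "set (b' (s i)) \<subseteq> params (underS \<mu> (s (Suc i)))" for i
      using bad_s[of i] unfolding bad_def s_Suc by blast+
    have params_s: "params (underS \<mu> (s i)) \<subseteq> params (underS \<mu> (s j))" if "i \<le> j" for i j
      by (intro params_mono underS_mono s_leq that)
    have params_A1: "params (underS \<mu> (s i)) \<subseteq> params (underS \<mu> (hd A1))" if "i \<le> N" for i
      using params_s[OF that] params_mono[OF underS_mono[OF less_imp_leq[OF hdA1]]] by blast
    have params_Dom: "params (underS \<mu> \<alpha>) \<subseteq> Dom M" for \<alpha>
      using Dom less_Field by (auto simp: params_def)
    have transfer: "sat_list M (map (val A1) q) \<psi> \<longleftrightarrow> sat_list M (map (val (A (s i))) q) \<psi>"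
      if "i < N" "\<psi> \<in> formulas L" "set q \<subseteq> codes UNIV (params (underS \<mu> (s (Suc i))))" for i q \<psi>
    proof (rule coherent)
      show "ksub A1" "\<psi> \<in> formulas L" using A1 that by auto
      show "ksub (A (s i))" using bad_s[of i] unfolding bad_def by blast
      show "set q \<subseteq> codes UNIV (params (underS \<mu> (hd (A (s i)))))" using that(3) by (simp add: s_Suc)
      show "set q \<subseteq> codes UNIV (params (underS \<mu> (hd A1)))"
        using that(3) codes_mono[OF order_refl params_A1[of "Suc i"]] that(1) by auto
    qed
    have "k_pattern L M k (length sl) m \<phi> N (tuple sl A1) (\<lambda>i. b (s i)) (\<lambda>i. b' (s i))"
      unfolding k_pattern_def
    proof (intro conjI ballI allI impI)
      have lenA1: "length A1 = k" using A1 by (simp add: ksub_def)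
      show "length (tuple sl A1) = k" using lenA1 by (simp add: tuple_def)
      show "length x = length sl" if "x \<in> set (tuple sl A1)" for x using that by (auto simp: tuple_def)
      show "set x \<subseteq> Dom M" if "x \<in> set (tuple sl A1)" for x
        using that A1(1) X_Field sl Dom(2) by (force simp: tuple_def ksub_def)
      fix i assume i: "i < N"
      have bi: "bad \<phi> sl m (s i) (A (s i)) (b (s i)) (b' (s i))" by (rule bad_s)
      then have lenAi: "length (A (s i)) = k" by (simp add: bad_def ksub_def)
      show "length (b (s i)) = m" "length (b' (s i)) = m" using bi by (auto simp: bad_def)
      show "set (b (s i)) \<subseteq> Dom M" "set (b' (s i)) \<subseteq> Dom M" using b_params params_Dom by blast+
      let ?q = "concat (map (\<lambda>p. map (\<lambda>g. Inl (p, g)) sl) [0..<k])"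
      have sat: "sat_list M (concat (tuple sl A1) @ c) \<phi> \<longleftrightarrow> sat_list M (concat (tuple sl (A (s i))) @ c) \<phi>"
        if "set c \<subseteq> params (underS \<mu> (s (Suc i)))" for c
        using transfer[OF i \<phi>(1), of "?q @ map Inr c"] that sl
        by (simp add: concat_tuple[OF lenA1] concat_tuple[OF lenAi] comp_def)
          (auto simp: codes_def)
      show "sat_list M (concat (tuple sl A1) @ b (s i)) \<phi>"
        "\<not> sat_list M (concat (tuple sl A1) @ b' (s i)) \<phi>"
        using bi sat b_params by (auto simp: bad_def)
      fix p assume p: "p < k"
      show "same_type_over L M ((\<Union>j<i. set (b (s j)) \<union> set (b' (s j))) \<union>
        (\<Union>j\<in>{..<k} - {p}. set (tuple sl A1 ! j))) (b (s i)) (b' (s i))"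
        unfolding same_type_over_iff
      proof (intro conjI allI impI; (elim conjE)?)
        show len: "length (b (s i)) = length (b' (s i))" using bi by (simp add: bad_def)
        fix \<psi> ss d
        assume \<psi>: "\<psi> \<in> formulas L" "fv \<psi> \<subseteq> {..<length ss + length d}"
          and ss: "set ss \<subseteq> {..<length (b (s i))}"
          and d: "set d \<subseteq> (\<Union>j<i. set (b (s j)) \<union> set (b' (s j))) \<union>
            (\<Union>j\<in>{..<k} - {p}. set (tuple sl A1 ! j))"
        let ?D = "(({..<k} - {p}) \<times> set sl) <+> params (underS \<mu> (s i))"
        have "set (b (s j)) \<union> set (b' (s j)) \<subseteq> params (underS \<mu> (s i))" if "j < i" for j
          using b_params[of j] params_s[of "Suc j" i] that by auto
        then have "(\<Union>j<i. set (b (s j)) \<union> set (b' (s j))) \<subseteq> params (underS \<mu> (s i))"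
          by (intro UN_least) simp
        from subset_trans[OF d Un_mono[OF this order_refl]] have "set d \<subseteq> params (underS \<mu> (s i)) \<union> (\<Union>j\<in>{..<k} - {p}. set (tuple sl A1 ! j))"
          .
        also have "\<dots> \<subseteq> val A1 ` ?D"
        proof
          fix z assume "z \<in> params (underS \<mu> (s i)) \<union> (\<Union>j\<in>{..<k} - {p}. set (tuple sl A1 ! j))"
          then consider "z \<in> params (underS \<mu> (s i))" | j g where "j < k" "j \<noteq> p" "g \<in> set sl" "z = a (A1 ! j) g"
            using lenA1 by (auto simp: tuple_def)
          then show "z \<in> val A1 ` ?D"
          proof cases
            case 1
            then show ?thesis by (intro image_eqI[of _ _ "Inr z"]) auto
          next
            case (2 j g)
            then show ?thesis by (intro image_eqI[of _ _ "Inl (j, g)"]) auto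
          qed
        qed
        finally have "d \<in> lists (val A1 ` ?D)" by blast
        then obtain ds where ds: "set ds \<subseteq> ?D" "d = map (val A1) ds" unfolding lists_image by auto
        \<comment> \<open>The parameters \<open>d\<close> may come from the tuples at
          \<open>A1\<close>. Reading their codes at \<open>A (s i)\<close> gives parameters for
          which the pair is known to have equal types; coherence carries the formula there and
          back.\<close>
        let ?d = "map (val (A (s i))) ds"
        have d': "set ?d \<subseteq> params (underS \<mu> (s i)) \<union> (\<Union>j\<in>{..<k} - {p}. set (tuple sl (A (s i)) ! j))"
        proof
          fix z assume "z \<in> set ?d"
          then obtain w where w: "w \<in> ?D" "z = val (A (s i)) w" using ds(1) by auto
          then show "z \<in> params (underS \<mu> (s i)) \<union> (\<Union>j\<in>{..<k} - {p}. set (tuple sl (A (s i)) ! j))"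
          proof (cases w)
            case (Inl x)
            obtain j g where x: "x = (j, g)" by (cases x)
            then have "j \<in> {..<k} - {p}" "g \<in> set sl" using w Inl by auto
            moreover from this have "z \<in> set (tuple sl (A (s i)) ! j)"
              using w Inl x lenAi by (auto simp: tuple_def)
            ultimately show ?thesis by blast
          qed (use w in auto)
        qed
        have codes: "set (map (\<lambda>t. Inr (c ! t)) ss @ ds) \<subseteq> codes UNIV (params (underS \<mu> (s (Suc i))))"
          if "set c \<subseteq> params (underS \<mu> (s (Suc i)))" "length c = m" for c
        proof -
          have "c ! t \<in> params (underS \<mu> (s (Suc i)))" if "t \<in> set ss" for t
          proof -
            have "t < length c" using \<open>length c = m\<close> that ss bi by (auto simp: bad_def)
            then show ?thesis using nth_mem \<open>set c \<subseteq> _\<close> by blast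
          qed
          moreover have "?D \<subseteq> codes UNIV (params (underS \<mu> (s (Suc i))))"
            using sl params_s[of i "Suc i"] by (auto simp: codes_def)
          ultimately show ?thesis using ds(1) by (auto simp: codes_def)
        qed
        have step: "sat_list M (map ((!) c) ss @ d) \<psi> \<longleftrightarrow> sat_list M (map ((!) c) ss @ ?d) \<psi>"
          if "set c \<subseteq> params (underS \<mu> (s (Suc i)))" "length c = m" for c
          using transfer[OF i \<psi>(1) codes[OF that]] by (simp add: ds comp_def)
        have "sat_list M (map ((!) (b (s i))) ss @ ?d) \<psi> \<longleftrightarrow> sat_list M (map ((!) (b' (s i))) ss @ ?d) \<psi>"
          using bi p \<psi> ss d' ds unfolding bad_def same_type_over_iff by simp
        then show "sat_list M (map ((!) (b (s i))) ss @ d) \<psi> \<longleftrightarrow> sat_list M (map ((!) (b' (s i))) ss @ d) \<psi>"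
          using step[of "b (s i)"] step[of "b' (s i)"] b_params[of i] bi by (simp add: bad_def)
      qed
    qed
    then show False using N by blast
  qed
  then have "\<forall>key\<in>keys. \<exists>\<delta>\<in>Field \<mu>. \<forall>\<phi> sl m A b b'. key = (\<phi>, sl, m) \<longrightarrow> \<not> bad \<phi> sl m \<delta> A b b'" by auto
  then obtain dl where dl: "\<And>key. key \<in> keys \<Longrightarrow> dl key \<in> Field \<mu>"
    "\<And>\<phi> sl m A b b'. (\<phi>, sl, m) \<in> keys \<Longrightarrow> \<not> bad \<phi> sl m (dl (\<phi>, sl, m)) A b b'" by metis
  obtain \<delta> where \<delta>: "\<delta> \<in> Field \<mu>" "\<And>key. key \<in> keys \<Longrightarrow> dl key \<lhd> \<delta>"
    using small_bounded_image[OF small_keys, of dl] dl(1) by blast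
  have "\<not> k_splits L M (tuple sl A) (params (underS \<mu> (hd A))) (params (underS \<mu> \<delta>))"
    if A: "ksub A" "\<delta> \<lhd> hd A" and sl: "set sl \<subseteq> G" for A sl
  proof
    have lenA: "length (tuple sl A) = k" "length A = k" using A by (auto simp: ksub_def tuple_def)
    assume "k_splits L M (tuple sl A) (params (underS \<mu> (hd A))) (params (underS \<mu> \<delta>))"
    then obtain \<phi> b b' where \<phi>: "\<phi> \<in> formulas L" "fv \<phi> \<subseteq> {..<k * length sl + length b}"
      and b: "set b \<subseteq> params (underS \<mu> (hd A))" "set b' \<subseteq> params (underS \<mu> (hd A))"
        "length b = length b'"
      and st: "\<And>p. p < k \<Longrightarrow>
        same_type_over L M (params (underS \<mu> \<delta>) \<union> (\<Union>j\<in>{..<k} - {p}. set (tuple sl A ! j))) b b'"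
      and sat: "sat_list M (concat (tuple sl A) @ b) \<phi>" "\<not> sat_list M (concat (tuple sl A) @ b') \<phi>"
      unfolding k_splits_def length_concat_tuple lenA by metis
    let ?key = "(\<phi>, sl, length b)"
    have key: "?key \<in> keys" using \<phi> sl by (simp add: keys_def)
    have dl\<delta>: "dl ?key \<lhd> \<delta>" by (rule \<delta>(2)[OF key])
    \<comment> \<open>Equal types over the base at \<delta> give equal types over the smaller base
      at \<open>dl ?key\<close>, where witnesses for this key are excluded.\<close>
    have "params (underS \<mu> (dl ?key)) \<subseteq> params (underS \<mu> \<delta>)"
      by (intro params_mono underS_mono less_imp_leq dl\<delta>)
    then have "same_type_over L M (params (underS \<mu> (dl ?key)) \<union> (\<Union>j\<in>{..<k} - {p}. set (tuple sl A ! j))) b b'"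
      if "p < k" for p by (intro same_type_over_mono[OF st[OF that]]) blast
    then have "bad \<phi> sl (length b) (dl ?key) A b b'"
      unfolding bad_def using A b sat less_trans[OF dl\<delta> A(2)] by simp
    then show False using dl(2)[OF key] by blast
  qed
  then show ?thesis using \<delta>(1) by blast
qed

end

section \<open>Indiscernibility\<close>

lemma nth_concat_uniform:
  "\<forall>x\<in>set ls. length x = n \<Longrightarrow> p < length ls \<Longrightarrow> t < n \<Longrightarrow> concat ls ! (p * n + t) = ls ! p ! t"
proof (induction ls arbitrary: p)
  case (Cons x ls)
  then show ?case by (cases p) (auto simp: nth_append)
qed simp

context coherent_sequence
begin

context
  fixes \<delta> :: 'c
  assumes nonsplit: "\<And>A sl. ksub A \<Longrightarrow> \<delta> \<lhd> hd A \<Longrightarrow> set sl \<subseteq> G \<Longrightarrow>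
    \<not> k_splits L M (tuple sl A) (params (underS \<mu> (hd A))) (params (underS \<mu> \<delta>))"
begin

text \<open>The parameters include all tuples before \<delta> and not only \<open>B\<close>:
  nonsplitting is known over this base, and it requires equality of types over the same
  base.\<close>

definition same_tuples :: "nat \<Rightarrow> bool" where
  "same_tuples N \<longleftrightarrow> (\<forall>i j \<phi> q. inc i \<and> inc j \<and> set i \<subseteq> {x \<in> X. \<delta> \<lhd> x} \<and> set j \<subseteq> {x \<in> X. \<delta> \<lhd> x} \<and>
    length i = N \<and> length j = N \<and> \<phi> \<in> formulas L \<and> fv \<phi> \<subseteq> {..<length q} \<and>
    set q \<subseteq> codes {..<N} (params (underS \<mu> \<delta>)) \<longrightarrow>
    (sat_list M (map (val i) q) \<phi> \<longleftrightarrow> sat_list M (map (val j) q) \<phi>))"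

text \<open>
  Nonsplitting over \<open>params (underS \<mu> \<delta>)\<close> moves the initial segment \<open>i\<close> to \<open>j\<close>: by assumption, the two have the same type
  over all but one of the \<open>k\<close> tuples with indices in \<open>A\<close>. In the formula required by the definition of
  splitting, the variable \<open>t\<close> is renamed to \<open>p * length q + t\<close>, where \<open>p\<close> is the block that it belongs to.
\<close>

lemma change_initial_segment:
  assumes IH: "same_tuples (n + k - 1)" and n: "1 \<le> n"
    and i: "inc i" "set i \<subseteq> {x \<in> X. \<delta> \<lhd> x}" "length i = n"
    and j: "inc j" "set j \<subseteq> {x \<in> X. \<delta> \<lhd> x}" "length j = n"
    and A: "ksub A" "\<And>x y. x \<in> set i \<union> set j \<Longrightarrow> y \<in> set A \<Longrightarrow> x \<lhd> y"
    and \<phi>: "\<phi> \<in> formulas L" "fv \<phi> \<subseteq> {..<length q}"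
    and q: "set q \<subseteq> codes {..<n + k} (params (underS \<mu> \<delta>))"
    and sat: "sat_list M (map (val (i @ A)) q) \<phi>"
  shows "sat_list M (map (val (j @ A)) q) \<phi>"
proof (cases "G = {}")
  case True
  have "map (val (i @ A)) q = map (val (j @ A)) q"
    using q unfolding codes_def by (auto simp: \<open>G = {}\<close>)
  then show ?thesis using sat by (simp only:)
next
  case False
  then obtain g0 where g0: "g0 \<in> G" by blast
  let ?D = "params (underS \<mu> \<delta>)" and ?l = "length q"
  have A': "inc A" "set A \<subseteq> X" "length A = k" using A(1) by (auto simp: ksub_def)
  have i0: "i ! 0 \<in> set i" using i n by simp
  have \<delta>A: "\<delta> \<lhd> y" if "y \<in> set A" for y
  proof -
    have "\<delta> \<lhd> i ! 0" using i0 i(2) by blast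
    then show ?thesis using A(2)[of "i ! 0" y] i0 that less_trans by blast
  qed
  have \<delta>_hd: "\<delta> \<lhd> hd A" using \<delta>A ksub_hd A(1) by blast
  \<comment> \<open>Each block lists the coordinates of all entries of \<open>q\<close>, so all
    blocks have length \<open>?l\<close>; \<open>g0\<close> fills the places of parameters.\<close>
  define sl where "sl = map (\<lambda>c. case c of Inl (p, g) \<Rightarrow> g | Inr _ \<Rightarrow> g0) q"
  \<comment> \<open>Entries of the last \<open>k\<close> tuples are padded by position 0, which
    exists as \<open>1 \<le> n\<close>. The resulting \<open>b l\<close> involves only
    \<open>l\<close> and parameters.\<close>
  define init :: "nat \<times> 'g + 'm \<Rightarrow> nat \<times> 'g + 'm"
    where "init c = (case c of Inl (p, g) \<Rightarrow> Inl (if p < n then p else 0, g) | Inr m \<Rightarrow> Inr m)" for c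
  define block where "block t = (case q ! t of Inl (p, g) \<Rightarrow> if p < n then k else p - n | Inr _ \<Rightarrow> k)" for t
  define pos where "pos t = (if t < ?l then block t * ?l + t else k * ?l + ?l + t)" for t
  have lsl: "length sl = ?l" by (simp add: sl_def)
  have q_cases: "(\<exists>m\<in>?D. c = Inr m) \<or> (\<exists>p<n + k. \<exists>g\<in>G. c = Inl (p, g))" if "c \<in> set q" for c
    using q that by (auto simp: codes_def)
  have sl_G: "set sl \<subseteq> G" using q_cases g0 by (fastforce simp: sl_def)
  have block: "block t \<le> k" if "t < ?l" for t
    using q_cases[OF nth_mem[OF that]] by (auto simp: block_def)
  have pos_less: "pos t < k * ?l + ?l" if "t < ?l" for t
  proof -
    have "block t * ?l + t < k * ?l + ?l"
      by (intro add_le_less_mono mult_le_mono1 block that)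
    then show ?thesis by (simp only: pos_def that if_True)
  qed
  have "inj pos"
  proof (rule injI)
    fix s t assume eq: "pos s = pos t"
    show "s = t"
    proof (cases "s < ?l \<and> t < ?l")
      case True
      then have "pos s mod ?l = s" "pos t mod ?l = t" by (simp_all add: pos_def)
      then show ?thesis using eq by metis
    next
      case False
      have ge: "pos u = k * ?l + ?l + u" if "\<not> u < ?l" for u using that by (simp only: pos_def if_False)
      show ?thesis
      proof (cases "s < ?l \<or> t < ?l")
        case True
        then show ?thesis using False eq pos_less[of s] pos_less[of t] ge[of s] ge[of t] by linarith
      next
        case False
        then show ?thesis using eq ge[of s] ge[of t] by linarith
      qed
    qed
  qed
  define b where "b l = map (val l) (map init q)" for l
  have tup: "concat (tuple sl A) ! (p * ?l + t) = a (A ! p) (sl ! t)" if "p < k" "t < ?l" for p t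
    using nth_concat_uniform[of "tuple sl A" ?l p t] that lsl A' by (auto simp: tuple_def)
  have len_tup: "length (concat (tuple sl A)) = k * ?l" by (simp add: length_concat_tuple A' lsl)
  have val_pos: "(concat (tuple sl A) @ b l) ! pos t = val (l @ A) (q ! t)"
    if t: "t < ?l" and l: "length l = n" for t l
  proof (cases "\<exists>p g. q ! t = Inl (p, g) \<and> n \<le> p")
    case True
    then obtain p g where p: "q ! t = Inl (p, g)" "n \<le> p" by blast
    then have "p < n + k" using q_cases[OF nth_mem[OF t]] by auto
    then have pk: "p - n < k" using p by auto
    have "pos t = (p - n) * ?l + t" using t p by (simp add: pos_def block_def)
    moreover have "(p - n) * ?l + t < k * ?l"
    proof -
      have "(p - n) * ?l + t < (p - n) * ?l + ?l" using t by simp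
      also have "\<dots> = Suc (p - n) * ?l" by simp
      also have "\<dots> \<le> k * ?l" using pk by (intro mult_le_mono1) simp
      finally show ?thesis .
    qed
    ultimately have "(concat (tuple sl A) @ b l) ! pos t = a (A ! (p - n)) (sl ! t)"
      using tup[OF pk t] by (simp add: nth_append len_tup)
    also have "\<dots> = val (l @ A) (q ! t)" using t p l by (simp add: sl_def nth_append)
    finally show ?thesis .
  next
    case False
    then have "pos t = k * ?l + t" using t by (auto simp: pos_def block_def split: sum.split)
    then have "(concat (tuple sl A) @ b l) ! pos t = val l (init (q ! t))"
      using t by (simp add: nth_append len_tup b_def)
    also have "\<dots> = val (l @ A) (q ! t)"
      using False l by (cases "q ! t") (auto simp: init_def nth_append split: prod.split)
    finally show ?thesis .
  qed
  have sat_b: "sat_list M (concat (tuple sl A) @ b l) (ren pos \<phi>) \<longleftrightarrow> sat_list M (map (val (l @ A)) q) \<phi>"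
    if "length l = n" for l
    unfolding sat_ren[OF \<open>inj pos\<close>]
    by (rule sat_cong) (use \<phi>(2) val_pos that in auto)
  have init_codes: "init c \<in> codes {..<n} ?D" if "c \<in> set q" for c
    using q_cases[OF that] n by (auto simp: init_def codes_def)
  have b_params: "set (b l) \<subseteq> params (underS \<mu> (hd A))"
    if l: "length l = n" "\<And>x. x \<in> set l \<Longrightarrow> x \<lhd> hd A" for l
  proof
    fix z assume "z \<in> set (b l)"
    then obtain c where c: "c \<in> codes {..<n} ?D" "z = val l c" using init_codes by (auto simp: b_def)
    show "z \<in> params (underS \<mu> (hd A))"
    proof (cases c)
      case (Inl x)
      obtain p g where x: "x = (p, g)" by (cases x)
      then have "p < n" "g \<in> G" using Inl c by (auto simp: codes_def)
      moreover from this have "l ! p \<lhd> hd A" using l by simp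
      ultimately show ?thesis using Inl x c by (auto simp: params_def)
    next
      case (Inr m)
      then have "z \<in> ?D" using c by (auto simp: codes_def)
      then show ?thesis using params_mono[OF underS_mono[OF less_imp_leq[OF \<delta>_hd]]] by blast
    qed
  qed
  have hdA: "hd A \<in> set A" using ksub_hd A(1) by blast
  have st: "same_type_over L M (?D \<union> (\<Union>u\<in>{..<k} - {p}. set (tuple sl A ! u))) (b i) (b j)"
    if p: "p < k" for p
    unfolding same_type_over_iff
  proof (intro conjI allI impI; (elim conjE)?)
    show "length (b i) = length (b j)" by (simp add: b_def)
    fix \<psi> ss d
    assume \<psi>: "\<psi> \<in> formulas L" "fv \<psi> \<subseteq> {..<length ss + length d}"
      and ss: "set ss \<subseteq> {..<length (b i)}"
      and d: "set d \<subseteq> ?D \<union> (\<Union>u\<in>{..<k} - {p}. set (tuple sl A ! u))"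
    \<comment> \<open>Without entry \<open>p\<close>, the indices in \<open>A\<close> still follow
      \<open>i\<close> or \<open>j\<close> in increasing order and bring the length to
      \<open>n + k - 1\<close>, as in the assumption.\<close>
    define A1 where "A1 = take p A @ drop (Suc p) A"
    have "A = take p A @ A ! p # drop (Suc p) A" using p A'(3) by (simp add: id_take_nth_drop)
    then have "inc (take p A @ A ! p # drop (Suc p) A)" using A'(1) by simp
    then have incA1: "inc A1" unfolding A1_def sorted_wrt_append by auto
    have setA1: "set A1 \<subseteq> set A" using set_take_subset[of p A] set_drop_subset[of "Suc p" A]
      by (auto simp: A1_def)
    have lenA1: "length A1 = k - 1" using p A'(3) by (simp add: A1_def)
    define idx where "idx u = (if u < p then u else u - 1)" for u
    have A1_idx: "A1 ! idx u = A ! u" "idx u < k - 1" if "u < k" "u \<noteq> p" for u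
      using that p A'(3) by (auto simp: A1_def idx_def nth_append min_def)
    have incl: "inc (l @ A1)" if "inc l" "set l \<subseteq> set i \<union> set j" for l
      using that incA1 setA1 A(2) unfolding sorted_wrt_append by blast
    \<comment> \<open>A parameter does not involve the initial segment, so one code has it as value
      under both \<open>i @ A1\<close> and \<open>j @ A1\<close>. This turns the claim into one
      about two increasing lists.\<close>
    have code: "\<exists>c\<in>codes {..<n + k - 1} ?D. val (i @ A1) c = z \<and> val (j @ A1) c = z" if "z \<in> set d" for z
    proof -
      have "z \<in> ?D \<union> (\<Union>u\<in>{..<k} - {p}. set (tuple sl A ! u))" using d that by blast
      then consider "z \<in> ?D" | u g where "u < k" "u \<noteq> p" "g \<in> G" "z = a (A ! u) g"
        using A'(3) sl_G by (auto simp: tuple_def)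
      then show ?thesis
      proof cases
        case 1
        then show ?thesis by (intro bexI[of _ "Inr z"]) (auto simp: codes_def)
      next
        case (2 u g)
        then show ?thesis using A1_idx[of u] i(3) j(3)
          by (intro bexI[of _ "Inl (n + idx u, g)"]) (auto simp: codes_def nth_append)
      qed
    qed
    then obtain cd where cd: "\<And>z. z \<in> set d \<Longrightarrow>
        cd z \<in> codes {..<n + k - 1} ?D \<and> val (i @ A1) (cd z) = z \<and> val (j @ A1) (cd z) = z" by metis
    let ?q = "map (\<lambda>t. init (q ! t)) ss @ map cd d"
    have ss': "t < ?l" if "t \<in> set ss" for t using ss that by (auto simp: b_def)
    have eval: "map (val (l @ A1)) ?q = map ((!) (b l)) ss @ d"
      if l: "length l = n" "\<And>z. z \<in> set d \<Longrightarrow> val (l @ A1) (cd z) = z" for l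
    proof -
      have "val (l @ A1) c = val l c" if "c \<in> codes {..<n} ?D" for c
        using that l(1) by (auto simp: codes_def nth_append)
      then have "map (val (l @ A1)) (map (\<lambda>t. init (q ! t)) ss) = map ((!) (b l)) ss"
        using ss' init_codes by (simp add: b_def)
      moreover have "map (val (l @ A1)) (map cd d) = d" using l(2) by (simp add: map_idI)
      ultimately show ?thesis by simp
    qed
    have "sat_list M (map (val (i @ A1)) ?q) \<psi> \<longleftrightarrow> sat_list M (map (val (j @ A1)) ?q) \<psi>"
    proof (rule IH[unfolded same_tuples_def, rule_format], intro conjI)
      show "inc (i @ A1)" "inc (j @ A1)" using incl i j by auto
      show "set (i @ A1) \<subseteq> {x \<in> X. \<delta> \<lhd> x}" "set (j @ A1) \<subseteq> {x \<in> X. \<delta> \<lhd> x}"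
        using i(2) j(2) setA1 A'(2) \<delta>A by auto
      show "length (i @ A1) = n + k - 1" "length (j @ A1) = n + k - 1"
        using i(3) j(3) lenA1 p by auto
      show "set ?q \<subseteq> codes {..<n + k - 1} ?D"
        using cd init_codes ss' codes_mono[of "{..<n}" "{..<n + k - 1}" ?D ?D] k_pos by fastforce
    qed (use \<psi> in auto)
    moreover have "map (val (i @ A1)) ?q = map ((!) (b i)) ss @ d"
      by (rule eval[OF i(3)]) (use cd in blast)
    moreover have "map (val (j @ A1)) ?q = map ((!) (b j)) ss @ d"
      by (rule eval[OF j(3)]) (use cd in blast)
    ultimately show "sat_list M (map ((!) (b i)) ss @ d) \<psi> \<longleftrightarrow> sat_list M (map ((!) (b j)) ss @ d) \<psi>"
      by (simp only:)
  qed
  have "set (b i) \<subseteq> params (underS \<mu> (hd A))" "set (b j) \<subseteq> params (underS \<mu> (hd A))"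
    using b_params[OF i(3)] b_params[OF j(3)] A(2) hdA by auto
  moreover have "ren pos \<phi> \<in> formulas L" using \<phi>(1) by (simp add: formulas_def wf_ren)
  moreover have "fv (ren pos \<phi>) \<subseteq> {..<length (concat (tuple sl A)) + length (b i)}"
    using \<phi>(2) pos_less by (auto simp: fv_ren[OF \<open>inj pos\<close>] len_tup b_def)
  moreover have "length (tuple sl A) = k" by (simp add: tuple_def A')
  moreover have "length (b i) = length (b j)" by (simp add: b_def)
  ultimately have "sat_list M (concat (tuple sl A) @ b j) (ren pos \<phi>)"
    if "sat_list M (concat (tuple sl A) @ b i) (ren pos \<phi>)"
    using nonsplit[OF A(1) \<delta>_hd sl_G] st that unfolding k_splits_def by blast
  then show ?thesis using sat sat_b[OF i(3)] sat_b[OF j(3)] by blast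
qed

text \<open>Both lists receive the same final segment \<open>A\<close>, above all their indices, so
  that afterwards only the initial segments differ.\<close>

lemma same_tuples_step:
  assumes IH: "same_tuples (n + k - 1)" and n: "1 \<le> n"
  shows "same_tuples (n + k)"
  unfolding same_tuples_def
proof (intro allI impI; elim conjE)
  let ?D = "params (underS \<mu> \<delta>)"
  fix i j \<phi> q
  assume i: "inc i" "set i \<subseteq> {x \<in> X. \<delta> \<lhd> x}" "length i = n + k"
    and j: "inc j" "set j \<subseteq> {x \<in> X. \<delta> \<lhd> x}" "length j = n + k"
    and \<phi>: "\<phi> \<in> formulas L" "fv \<phi> \<subseteq> {..<length q}" and q: "set q \<subseteq> codes {..<n + k} ?D"
  have "set i \<union> set j \<subseteq> Field \<mu>" using i j X_Field by auto
  then obtain \<beta> where \<beta>: "\<beta> \<in> Field \<mu>" "\<And>x. x \<in> set i \<union> set j \<Longrightarrow> x \<lhd> \<beta>"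
    using finite_bounded[of "set i \<union> set j"] by auto
  obtain A where A: "ksub A" "\<forall>x\<in>set A. \<beta> \<lhd> x" using ex_ksub_above[OF \<beta>(1)] by blast
  have above: "x \<lhd> y" if "x \<in> set i \<union> set j" "y \<in> set A" for x y
    using \<beta>(2)[OF that(1)] A(2) that(2) less_trans by blast
  have change_end: "sat_list M (map (val l) q) \<phi> \<longleftrightarrow> sat_list M (map (val (take n l @ A)) q) \<phi>"
    if l: "inc l" "set l \<subseteq> {x \<in> X. \<delta> \<lhd> x}" "length l = n + k" "set l \<subseteq> set i \<union> set j" for l
  proof -
    \<comment> \<open>Indices before position \<open>n\<close> lie below the head of the final
      segment \<open>?I\<close>. Once their entries are parameters, coherence for
      \<open>k\<close>-tuples applies to \<open>?I\<close> and \<open>A\<close>.\<close>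
    define tr :: "nat \<times> 'g + 'm \<Rightarrow> nat \<times> 'g + 'm" where
      "tr c = (case c of Inl (p, g) \<Rightarrow> if p < n then Inr (a (l ! p) g) else Inl (p - n, g) | Inr m \<Rightarrow> Inr m)" for c
    let ?I = "drop n l"
    have I: "ksub ?I" using l(1-3) set_drop_subset[of n l] by (auto simp: ksub_def sorted_wrt_drop)
    have hdI: "hd ?I = l ! n" using l(3) k_pos by (simp add: hd_drop_conv_nth)
    have hdI_l: "hd ?I \<in> set l" using ksub_hd(1)[OF I] set_drop_subset[of n l] by blast
    have hd_hd: "hd ?I \<lhd> hd A" using above[of "hd ?I" "hd A"] hdI_l l(4) ksub_hd(1)[OF A(1)] by blast
    have "set (map tr q) \<subseteq> codes UNIV (params (underS \<mu> (hd ?I)))"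
    proof -
      have "tr c \<in> codes UNIV (params (underS \<mu> (hd ?I)))" if "c \<in> codes {..<n + k} ?D" for c
      proof (cases c)
        case (Inl x)
        obtain p g where x: "x = (p, g)" by (cases x)
        then have g: "g \<in> G" using that Inl by (auto simp: codes_def)
        show ?thesis
        proof (cases "p < n")
          case True
          then have "l ! p \<lhd> hd ?I" using l(1,3) k_pos hdI by (auto simp: sorted_wrt_iff_nth_less)
          then show ?thesis using Inl x True g by (auto simp: tr_def codes_def params_def)
        qed (use Inl x g in \<open>auto simp: tr_def codes_def\<close>)
      next
        case (Inr m)
        then have "m \<in> ?D" using that by (auto simp: codes_def)
        moreover have "\<delta> \<lhd> hd ?I" using l(2) hdI_l by blast
        ultimately show ?thesis
          using Inr params_mono[OF underS_mono[OF less_imp_leq]] by (auto simp: tr_def codes_def)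
      qed
      then show ?thesis using q by auto
    qed
    moreover have "\<dots> \<subseteq> codes UNIV (params (underS \<mu> (hd A)))"
      by (intro codes_mono params_mono underS_mono less_imp_leq hd_hd order_refl)
    ultimately have "sat_list M (map (val ?I) (map tr q)) \<phi> \<longleftrightarrow> sat_list M (map (val A) (map tr q)) \<phi>"
      using coherent[OF I A(1) \<phi>(1)] by blast
    moreover have "val ?I (tr c) = val l c \<and> val A (tr c) = val (take n l @ A) c"
      if "c \<in> codes {..<n + k} ?D" for c
      using that l(3) by (auto simp: codes_def tr_def nth_append)
    then have "map (val ?I) (map tr q) = map (val l) q" "map (val A) (map tr q) = map (val (take n l @ A)) q"
      using q by auto
    ultimately show ?thesis by (simp only:)
  qed
  have take: "inc (take n l)" "set (take n l) \<subseteq> {x \<in> X. \<delta> \<lhd> x}" "length (take n l) = n"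
    if "inc l" "set l \<subseteq> {x \<in> X. \<delta> \<lhd> x}" "length l = n + k" for l
    using that set_take_subset[of n l] by (auto simp: sorted_wrt_take)
  have above': "x \<lhd> y" if "x \<in> set (take n i) \<union> set (take n j)" "y \<in> set A" for x y
    using that above set_take_subset[of n i] set_take_subset[of n j] by blast
  have "sat_list M (map (val (take n i @ A)) q) \<phi> \<longleftrightarrow> sat_list M (map (val (take n j @ A)) q) \<phi>"
    using change_initial_segment[OF IH n take[OF i] take[OF j] A(1) _ \<phi> q]
      change_initial_segment[OF IH n take[OF j] take[OF i] A(1) _ \<phi> q] above' by blast
  then show "sat_list M (map (val i) q) \<phi> \<longleftrightarrow> sat_list M (map (val j) q) \<phi>"
    using change_end[OF i] change_end[OF j] by blast
qed

text \<open>Length \<open>k\<close> is coherence itself, because \<delta> lies below both heads.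
  Each greater length is one exchange.\<close>

lemma same_tuples_ge:
  assumes "k \<le> N"
  shows "same_tuples N"
  using assms
proof (induction rule: dec_induct)
  case base
  show ?case unfolding same_tuples_def
  proof (intro allI impI; elim conjE)
    let ?D = "params (underS \<mu> \<delta>)"
    fix i j \<phi> q
    assume i: "inc i" "set i \<subseteq> {x \<in> X. \<delta> \<lhd> x}" "length i = k"
      and j: "inc j" "set j \<subseteq> {x \<in> X. \<delta> \<lhd> x}" "length j = k"
      and \<phi>: "\<phi> \<in> formulas L" and q: "set q \<subseteq> codes {..<k} ?D"
    have ks: "ksub i" "ksub j" using i j by (auto simp: ksub_def)
    have "set q \<subseteq> codes UNIV (params (underS \<mu> (hd l)))" if "ksub l" "set l \<subseteq> {x \<in> X. \<delta> \<lhd> x}" for l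
    proof -
      have "\<delta> \<lhd> hd l" using that ksub_hd by blast
      then show ?thesis
        using q codes_mono[OF subset_UNIV params_mono[OF underS_mono[OF less_imp_leq]]] by blast
    qed
    then show "sat_list M (map (val i) q) \<phi> \<longleftrightarrow> sat_list M (map (val j) q) \<phi>"
      using coherent[OF ks \<phi>] ks i j by blast
  qed
next
  case (step m)
  \<comment> \<open>For \<open>n = Suc m - k\<close> the length \<open>n + k - 1\<close> is
    \<open>m\<close>, and \<open>k \<le> m\<close> gives \<open>1 \<le> n\<close>.\<close>
  then show ?case using same_tuples_step[of "Suc m - k"] by simp
qed

text \<open>Short lists are padded to length \<open>k\<close> by common indices far above; codes
  with positions below \<open>N\<close> do not see the padding.\<close>

lemma same_tuples:
  assumes \<delta>: "\<delta> \<in> Field \<mu>"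
  shows "same_tuples N"
proof (cases "k \<le> N")
  case True
  then show ?thesis by (rule same_tuples_ge)
next
  case False
  show ?thesis unfolding same_tuples_def
  proof (intro allI impI; elim conjE)
    let ?D = "params (underS \<mu> \<delta>)"
    fix i j \<phi> q
    assume i: "inc i" "set i \<subseteq> {x \<in> X. \<delta> \<lhd> x}" "length i = N"
      and j: "inc j" "set j \<subseteq> {x \<in> X. \<delta> \<lhd> x}" "length j = N"
      and \<phi>: "\<phi> \<in> formulas L" "fv \<phi> \<subseteq> {..<length q}" and q: "set q \<subseteq> codes {..<N} ?D"
    have "insert \<delta> (set i \<union> set j) \<subseteq> Field \<mu>" using i j X_Field \<delta> by auto
    then obtain \<beta> where \<beta>: "\<beta> \<in> Field \<mu>" "\<And>x. x \<in> insert \<delta> (set i \<union> set j) \<Longrightarrow> x \<lhd> \<beta>"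
      using finite_bounded[of "insert \<delta> (set i \<union> set j)"] by auto
    obtain A where A: "inc A" "set A \<subseteq> X" "length A = k - N" "\<forall>x\<in>set A. \<beta> \<lhd> x"
      using ex_inc_above[OF X \<beta>(1), of "k - N"] by blast
    have above: "x \<lhd> y" if "x \<in> insert \<delta> (set i \<union> set j)" "y \<in> set A" for x y
      using \<beta>(2)[OF that(1)] A(4) that(2) less_trans by blast
    have "inc (i @ A)" "inc (j @ A)" using i(1) j(1) A(1) above unfolding sorted_wrt_append by blast+
    moreover have "set (i @ A) \<subseteq> {x \<in> X. \<delta> \<lhd> x}" "set (j @ A) \<subseteq> {x \<in> X. \<delta> \<lhd> x}"
      using i(2) j(2) A(2) above by auto
    moreover have "length (i @ A) = k" "length (j @ A) = k" using i(3) j(3) A(3) False by auto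
    moreover have "set q \<subseteq> codes {..<k} ?D"
      using q codes_mono[of "{..<N}" "{..<k}" ?D ?D] False by auto
    ultimately have "sat_list M (map (val (i @ A)) q) \<phi> \<longleftrightarrow> sat_list M (map (val (j @ A)) q) \<phi>"
      using same_tuples_ge[OF order_refl] \<phi> unfolding same_tuples_def by blast
    moreover have "val (l @ A) c = val l c" if "length l = N" "c \<in> set q" for l c
      using that q by (auto simp: codes_def nth_append)
    then have "map (val (i @ A)) q = map (val i) q" "map (val (j @ A)) q = map (val j) q"
      using i(3) j(3) by auto
    ultimately show "sat_list M (map (val i) q) \<phi> \<longleftrightarrow> sat_list M (map (val j) q) \<phi>" by (simp only:)
  qed
qed

text \<open>Variables of a triple in \<open>tp\<close> become codes \<open>Inl\<close> and its
  parameters codes \<open>Inr\<close>; \<open>B\<close> is part of the base in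
  \<open>same_tuples\<close>.\<close>

lemma indiscernible_above:
  assumes \<delta>: "\<delta> \<in> Field \<mu>"
  shows "indiscernible_over L M B \<mu> {x \<in> X. \<delta> \<lhd> x} G a"
  unfolding indiscernible_over_def
proof (intro allI impI; elim conjE)
  fix i j
  assume i: "set i \<subseteq> {x \<in> X. \<delta> \<lhd> x}" "inc i" and j: "set j \<subseteq> {x \<in> X. \<delta> \<lhd> x}" "inc j"
    and len: "length i = length j"
  have "sat_list M (map (\<lambda>(p, g). a (i ! p) g) s @ d) \<phi> \<longleftrightarrow>
    sat_list M (map (\<lambda>(p, g). a (j ! p) g) s @ d) \<phi>"
    if s: "set s \<subseteq> {..<length j} \<times> G" and d: "set d \<subseteq> B"
      and \<phi>: "\<phi> \<in> formulas L" "fv \<phi> \<subseteq> {..<length s + length d}" for s d \<phi>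
  proof -
    have "set (map Inl s @ map Inr d) \<subseteq> codes {..<length j} (params (underS \<mu> \<delta>))"
      using s d by (auto simp: codes_def params_def)
    then have "sat_list M (map (val i) (map Inl s @ map Inr d)) \<phi> \<longleftrightarrow>
        sat_list M (map (val j) (map Inl s @ map Inr d)) \<phi>"
      using same_tuples[OF \<delta>, of "length j", unfolded same_tuples_def, rule_format,
          of i j \<phi> "map Inl s @ map Inr d"] i j len \<phi> by simp
    moreover have "map (val l) (map Inl s @ map Inr d) = map (\<lambda>(p, g). a (l ! p) g) s @ d" for l
      by (auto intro: map_idI)
    ultimately show ?thesis by (simp only:)
  qed
  then show "tp L M B ({..<length i} \<times> G) (\<lambda>(p, g). a (i ! p) g) =
      tp L M B ({..<length j} \<times> G) (\<lambda>(p, g). a (j ! p) g)"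
    unfolding tp_def len by blast
qed

end

end

theorem theorem3p1:
  fixes L :: "('f, 'r) language"
    and T :: "('f, 'r) fm set"
    and M :: "('f, 'r, 'm) struct"
    and B :: "'m set"
    and \<gamma> :: "'g rel"
    and \<mu> :: "'c rel"
    and a :: "'c \<Rightarrow> 'g \<Rightarrow> 'm"
    and k :: nat
  assumes "k \<ge> 1"
    and "complete_theory L T"
    and "bounded_k_splitting TYPE('l) L T k"
    and "is_model L T M"
    and "B \<subseteq> Dom M"
    and "Well_order \<gamma>"
    and "ineffable k \<mu>"
    and "|formulas L| +c |B| +c |Field \<gamma>| <o \<mu>"
    and "\<And>i j. i \<in> Field \<mu> \<Longrightarrow> j \<in> Field \<gamma> \<Longrightarrow> a i j \<in> Dom M"
  shows "\<exists>X \<subseteq> Field \<mu>. |X| =o \<mu> \<and> indiscernible_over L M B \<mu> X (Field \<gamma>) a"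
proof -
  have small: "|formulas L| <o \<mu>" "|B| <o \<mu>" "|Field \<gamma>| <o \<mu>"
  proof -
    have "|B| +c |Field \<gamma>| \<le>o |formulas L| +c |B| +c |Field \<gamma>|"
      by (rule ordLeq_csum2) (rule Card_order_csum)
    then have BG: "|B| +c |Field \<gamma>| <o \<mu>" using assms(8) ordLeq_ordLess_trans by blast
    show "|formulas L| <o \<mu>"
      by (rule ordLeq_ordLess_trans[OF ordLeq_csum1[OF card_of_Card_order] assms(8)])
    show "|B| <o \<mu>"
      by (rule ordLeq_ordLess_trans[OF ordLeq_csum1[OF card_of_Card_order] BG])
    show "|Field \<gamma>| <o \<mu>"
      by (rule ordLeq_ordLess_trans[OF ordLeq_csum2[OF card_of_Card_order] BG])
  qed
  \<comment> \<open>The equations of a variable with itself are distinct formulas of any language,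
    so \<mu> is uncountable.\<close>
  have "|UNIV :: nat set| \<le>o |formulas L|"
    by (rule card_of_ordLeqI[of "\<lambda>x. Eq (Var x) (Var x)"]) (auto simp: inj_def formulas_def)
  then have "natLeq \<le>o |formulas L|"
    using card_of_nat ordIso_symmetric ordIso_ordLeq_trans by blast
  then have "natLeq <o \<mu>" using small(1) ordLeq_ordLess_trans by blast
  then interpret sequence_in_model \<mu> k L M B "Field \<gamma>" a
    using assms(1,7) small by unfold_locales
  obtain X where "coherent_sequence \<mu> k L M B (Field \<gamma>) a X"
  proof -
    obtain X where "unbounded X" "\<forall>A A' \<phi> q. inc A \<and> inc A' \<and> set A \<subseteq> X \<and> set A' \<subseteq> X \<and>
      length A = k \<and> length A' = k \<and> (hd A, hd A') \<in> \<mu> \<and> \<phi> \<in> formulas L \<and>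
      set q \<subseteq> codes UNIV (params (underS \<mu> (hd A))) \<longrightarrow>
      (sat_list M (map (val A) q) \<phi> \<longleftrightarrow> sat_list M (map (val A') q) \<phi>)"
      using ex_coherent_set by (elim exE conjE)
    then have "coherent_sequence \<mu> k L M B (Field \<gamma>) a X" by unfold_locales blast+
    then show thesis by (rule that)
  qed
  then interpret coherent_sequence \<mu> k L M B "Field \<gamma>" a X .
  have T: "T \<subseteq> sentences L" using assms(2) by (simp add: complete_theory_def)
  obtain \<delta> where \<delta>: "\<delta> \<in> Field \<mu>"
    "\<forall>A sl. ksub A \<longrightarrow> \<delta> \<lhd> hd A \<longrightarrow> set sl \<subseteq> Field \<gamma> \<longrightarrow>
      \<not> k_splits L M (tuple sl A) (params (underS \<mu> (hd A))) (params (underS \<mu> \<delta>))"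
    using eventually_nonsplitting[OF no_long_k_patterns[OF assms(3) T assms(4)] assms(5,9)] by blast
  have ind: "indiscernible_over L M B \<mu> {x \<in> X. \<delta> \<lhd> x} (Field \<gamma>) a"
    by (rule indiscernible_above) (use \<delta> in blast)+
  have unb: "unbounded {x \<in> X. \<delta> \<lhd> x}"
    unfolding unbounded_def
  proof (intro conjI ballI)
    show "{x \<in> X. \<delta> \<lhd> x} \<subseteq> Field \<mu>" using X_Field by blast
    fix \<beta> assume "\<beta> \<in> Field \<mu>"
    then obtain \<xi> where "\<xi> \<in> Field \<mu>" "\<beta> \<lhd> \<xi>" "\<delta> \<lhd> \<xi>"
      using finite_bounded[of "{\<beta>, \<delta>}"] \<delta>(1) by auto
    moreover from this obtain x where "x \<in> X" "\<xi> \<lhd> x" using X unfolding unbounded_def by blast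
    ultimately show "\<exists>x\<in>{x \<in> X. \<delta> \<lhd> x}. \<beta> \<lhd> x" using less_trans by blast
  qed
  have "{x \<in> X. \<delta> \<lhd> x} \<subseteq> Field \<mu>" using X_Field by blast
  then show ?thesis using ind unbounded_card[OF unb] by (intro exI conjI)
qed

end
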